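(* (Full normalization for $\mathsf{IEL}^{-}$.) Every well-typed proof term of $\lambda^{\Box\rightarrow\wedge\vee\bot}$ (equivalently, every $\mathsf{IEL}^{-}$-deduction) is strongly normalizing with respect to the one-step reduction relation given by the union of the detour conversions $>_{D}$, the permutation conversions $>_{P}$ and the $\bot$-conversions $>_{\bot}$; i.e. there is no infinite reduction sequence $t_0> t_1> t_2>\cdots$ with each step in $>_{D}\cup>_{P}\cup>_{\bot}$.
   Context: Formulas: built from propositional atoms and $\bot$ by $\wedge,\vee,\rightarrow$ and a unary modality $\Box$. $\mathsf{IEL}^{-}$ is the natural deduction system with the usual intuitionistic (NJ) introduction/elimination rules for $\wedge,\vee,\rightarrow$, ex falso ($\bot$-elimination: from $\bot$ infer any $A$), and one extra rule ($\Box$-intro): from deductions of $\Box A_1,\dots,\Box A_n$ (from assumptions $\Gamma_1,\dots,\Gamma_n$) and a deduction of $B$ from assumptions $A_1,\dots,A_n,\Delta$, infer $\Box B$, discharging $A_1,\dots,A_n$ ($n\ge 0$). Proof terms of $\lambda^{\Box\rightarrow\wedge\vee\bot}$: $x\mid \lambda x.t\mid ts\mid \langle t,s\rangle\mid \pi_1 t\mid \pi_2 t\mid \mathsf{in}_1 t\mid \mathsf{in}_2 t\mid \mathsf{C}_{x,y}(t,t_1,t_2)\mid \mathsf{E}(t)\mid \mathsf{B}_{x_1,\dots,x_n}(t_1,\dots,t_n)\,\mathsf{in}\,s$, where $\mathsf{C}$ binds $x$ in $t_1$ and $y$ in $t_2$, and $\mathsf{B}$ binds $x_1,\dots,x_n$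 in $s$. Typing is the standard Curry–Howard typing of the NJ rules ($\mathsf{E}(t):A$ when $t:\bot$), plus: if $\Gamma_i\vdash t_i:\Box A_i$ ($i=1..n$) and $x_1:A_1,\dots,x_n:A_n,\Delta\vdash s:B$ then $\Gamma_1,\dots,\Gamma_n,\Delta\vdash \mathsf{B}_{x_1,\dots,x_n}(t_1,\dots,t_n)\,\mathsf{in}\,s:\Box B$. Typed terms correspond to deductions. All reductions below are closed under arbitrary term contexts. Detours $>_D$: $(\lambda x.t)s> t[x:=s]$; $\pi_i\langle t_1,t_2\rangle> t_i$; $\mathsf{C}_{x_1,x_2}(\mathsf{in}_i t,t_1,t_2)> t_i[x_i:=t]$; $\mathsf{B}_{x_1,\dots,x_{i-1},x_i,x_{i+1},\dots,x_n}(t_1,\dots,t_{i-1},(\mathsf{B}_{\vec y}(\vec s)\,\mathsf{in}\,t_i),t_{i+1},\dots,t_n)\,\mathsf{in}\,r > \mathsf{B}_{x_1,\dots,x_{i-1},\vec y,x_{i+1},\dots,x_n}(t_1,\dots,t_{i-1},\vec s,t_{i+1},\dots,t_n)\,\mathsf{in}\,r[x_i:=t_i]$; $\mathsf{B}_x t\,\mathsf{in}\,x> t$. Permutations $>_P$: $\mathsf{C}_{x,y}(t,t_1,t_2)s>\mathsf{C}_{x,y}(t,t_1s,t_2s)$; $\pi_i\mathsf{C}_{x,y}(t,t_1,t_2)>\mathsf{C}_{x,y}(t,\pi_it_1,\pi_it_2)$; $\mathsf{C}_{u,v}(\mathsf{C}_{x,y}(t,t_1,t_2),s_1,s_2)>\mathsf{C}_{x,y}(t,\mathsf{C}_{u,v}(t_1,s_1,s_2),\mathsf{C}_{u,v}(t_2,s_1,s_2))$;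 $\mathsf{B}_{\vec x}(t_1,\dots,t_{i-1},\mathsf{C}_{x,y}(t,s_1,s_2),t_{i+1},\dots,t_n)\,\mathsf{in}\,s>\mathsf{C}_{x,y}(t,\mathsf{B}_{\vec x}(t_1,\dots,s_1,\dots,t_n)\,\mathsf{in}\,s,\ \mathsf{B}_{\vec x}(t_1,\dots,s_2,\dots,t_n)\,\mathsf{in}\,s)$; $\mathsf{E}(\mathsf{C}_{x,y}(t,t_1,t_2))>\mathsf{C}_{x,y}(t,\mathsf{E}(t_1),\mathsf{E}(t_2))$. $\bot$-conversions $>_\bot$: $\mathsf{E}(t)s>\mathsf{E}(t)$; $\pi_i\mathsf{E}(t)>\mathsf{E}(t)$; $\mathsf{C}_{x,y}(\mathsf{E}(t),t_1,t_2)>\mathsf{E}(t)$; $\mathsf{E}(\mathsf{E}(t))>\mathsf{E}(t)$; $\mathsf{B}_{\vec x}(t_1,\dots,t_{i-1},\mathsf{E}(t_i),t_{i+1},\dots,t_n)\,\mathsf{in}\,s>\mathsf{E}(t_i)$ (the $\mathsf{E}$ on the right being typed with the type of the redex). *)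

theory Defs
  imports Main
begin

datatype 'a form =
    Atom 'a
  | Bot
  | And "'a form" "'a form"
  | Or "'a form" "'a form"
  | Imp "'a form" "'a form"
  | Nec "'a form"

text \<open>
  Proof terms modulo renaming of bound variables, in de Bruijn notation.
  \<open>Lam t\<close> binds index 0 of \<open>t\<close>; \<open>Case t t1 t2\<close> binds index 0 of \<open>t1\<close> and index 0
  of \<open>t2\<close>. \<open>B ts s\<close> binds the indices below \<open>length ts\<close> in \<open>s\<close>, where index \<open>j\<close>
  is the variable paired with \<open>ts ! j\<close>; the indices from \<open>length ts\<close> on refer to the
  surrounding scope. As in the informal calculus, terms carry no type annotations.
\<close>

datatype trm =
    Var nat
  | Lam trm
  | App trm trm
  | Pair trm trm
  | Pr1 trm
  | Pr2 trm
  | In1 trm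
  | In2 trm
  | Case trm trm trm
  | E trm
  | B "trm list" trm

definition up_ren :: "nat \<Rightarrow> (nat \<Rightarrow> nat) \<Rightarrow> nat \<Rightarrow> nat" where
  "up_ren n \<rho> j = (if j < n then j else \<rho> (j - n) + n)"

fun rename :: "(nat \<Rightarrow> nat) \<Rightarrow> trm \<Rightarrow> trm" where
  "rename \<rho> (Var j) = Var (\<rho> j)"
| "rename \<rho> (Lam t) = Lam (rename (up_ren 1 \<rho>) t)"
| "rename \<rho> (App t s) = App (rename \<rho> t) (rename \<rho> s)"
| "rename \<rho> (Pair t s) = Pair (rename \<rho> t) (rename \<rho> s)"
| "rename \<rho> (Pr1 t) = Pr1 (rename \<rho> t)"
| "rename \<rho> (Pr2 t) = Pr2 (rename \<rho> t)"
| "rename \<rho> (In1 t) = In1 (rename \<rho> t)"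
| "rename \<rho> (In2 t) = In2 (rename \<rho> t)"
| "rename \<rho> (Case t t1 t2) =
     Case (rename \<rho> t) (rename (up_ren 1 \<rho>) t1) (rename (up_ren 1 \<rho>) t2)"
| "rename \<rho> (E t) = E (rename \<rho> t)"
| "rename \<rho> (B ts s) = B (map (rename \<rho>) ts) (rename (up_ren (length ts) \<rho>) s)"

definition up_sub :: "nat \<Rightarrow> (nat \<Rightarrow> trm) \<Rightarrow> nat \<Rightarrow> trm" where
  "up_sub n \<sigma> j = (if j < n then Var j else rename (\<lambda>k. k + n) (\<sigma> (j - n)))"

fun subst :: "(nat \<Rightarrow> trm) \<Rightarrow> trm \<Rightarrow> trm" where
  "subst \<sigma> (Var j) = \<sigma> j"
| "subst \<sigma> (Lam t) = Lam (subst (up_sub 1 \<sigma>) t)"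
| "subst \<sigma> (App t s) = App (subst \<sigma> t) (subst \<sigma> s)"
| "subst \<sigma> (Pair t s) = Pair (subst \<sigma> t) (subst \<sigma> s)"
| "subst \<sigma> (Pr1 t) = Pr1 (subst \<sigma> t)"
| "subst \<sigma> (Pr2 t) = Pr2 (subst \<sigma> t)"
| "subst \<sigma> (In1 t) = In1 (subst \<sigma> t)"
| "subst \<sigma> (In2 t) = In2 (subst \<sigma> t)"
| "subst \<sigma> (Case t t1 t2) =
     Case (subst \<sigma> t) (subst (up_sub 1 \<sigma>) t1) (subst (up_sub 1 \<sigma>) t2)"
| "subst \<sigma> (E t) = E (subst \<sigma> t)"
| "subst \<sigma> (B ts s) = B (map (subst \<sigma>) ts) (subst (up_sub (length ts) \<sigma>) s)"

text \<open>\<open>subst1 s t\<close> is $t[x := s]$ for the variable $x$ with index 0, whose binder disappears.\<close>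

definition subst1 :: "trm \<Rightarrow> trm \<Rightarrow> trm" where
  "subst1 s t = subst (\<lambda>j. case j of 0 \<Rightarrow> s | Suc k \<Rightarrow> Var k) t"

text \<open>
  \<open>\<Gamma> ! j\<close> is the type of the variable with index \<open>j\<close>. All premises share the context:
  with weakening this amounts to taking the union $\Gamma_1,\dots,\Gamma_n,\Delta$.
\<close>

inductive typed :: "'a form list \<Rightarrow> trm \<Rightarrow> 'a form \<Rightarrow> bool"
  ("_ \<turnstile> _ : _" [51, 51, 51] 50) where
  typed_Var: "j < length \<Gamma> \<Longrightarrow> \<Gamma> \<turnstile> Var j : \<Gamma> ! j"
| typed_Lam: "A # \<Gamma> \<turnstile> t : C \<Longrightarrow> \<Gamma> \<turnstile> Lam t : Imp A C"
| typed_App: "\<Gamma> \<turnstile> t : Imp A C \<Longrightarrow> \<Gamma> \<turnstile> s : A \<Longrightarrow> \<Gamma> \<turnstile> App t s : C"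
| typed_Pair: "\<Gamma> \<turnstile> t : A \<Longrightarrow> \<Gamma> \<turnstile> s : C \<Longrightarrow> \<Gamma> \<turnstile> Pair t s : And A C"
| typed_Pr1: "\<Gamma> \<turnstile> t : And A C \<Longrightarrow> \<Gamma> \<turnstile> Pr1 t : A"
| typed_Pr2: "\<Gamma> \<turnstile> t : And A C \<Longrightarrow> \<Gamma> \<turnstile> Pr2 t : C"
| typed_In1: "\<Gamma> \<turnstile> t : A \<Longrightarrow> \<Gamma> \<turnstile> In1 t : Or A C"
| typed_In2: "\<Gamma> \<turnstile> t : C \<Longrightarrow> \<Gamma> \<turnstile> In2 t : Or A C"
| typed_Case: "\<Gamma> \<turnstile> t : Or A C \<Longrightarrow> A # \<Gamma> \<turnstile> t1 : D \<Longrightarrow> C # \<Gamma> \<turnstile> t2 : D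
    \<Longrightarrow> \<Gamma> \<turnstile> Case t t1 t2 : D"
| typed_E: "\<Gamma> \<turnstile> t : Bot \<Longrightarrow> \<Gamma> \<turnstile> E t : A"
| typed_B: "list_all2 (\<lambda>t A. \<Gamma> \<turnstile> t : Nec A) ts As \<Longrightarrow> As @ \<Gamma> \<turnstile> s : C
    \<Longrightarrow> \<Gamma> \<turnstile> B ts s : Nec C"

text \<open>
  Merging \<open>B ss t\<close>, found at position \<open>k\<close> of the \<open>k + 1 + l\<close> arguments of a box with
  body \<open>r\<close>, replaces variable \<open>k\<close> by the \<open>m\<close> variables bound by \<open>B ss t\<close>.
  \<open>merge_body k m l t r\<close> is $r[x_k := t]$ in that new scope: in \<open>r\<close> the
  indices above \<open>k\<close> move by \<open>m - 1\<close>; in \<open>t\<close> the bound indices below \<open>m\<close> move by \<open>k\<close>,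
  past the variables on the left, and the free ones by \<open>k + l\<close>, past all the others.
\<close>

definition merge_body :: "nat \<Rightarrow> nat \<Rightarrow> nat \<Rightarrow> trm \<Rightarrow> trm \<Rightarrow> trm" where
  "merge_body k m l t r =
     subst (\<lambda>j. if j < k then Var j
                else if j = k then rename (\<lambda>i. if i < m then i + k else i + k + l) t
                else Var (j - 1 + m)) r"

inductive detour :: "trm \<Rightarrow> trm \<Rightarrow> bool" where
  "detour (App (Lam t) s) (subst1 s t)"
| "detour (Pr1 (Pair t1 t2)) t1"
| "detour (Pr2 (Pair t1 t2)) t2"
| "detour (Case (In1 t) t1 t2) (subst1 t t1)"
| "detour (Case (In2 t) t1 t2) (subst1 t t2)"
| "detour (B (ts1 @ B ss t # ts2) r)
     (B (ts1 @ ss @ ts2) (merge_body (length ts1) (length ss) (length ts2) t r))"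
| "detour (B [t] (Var 0)) t"

text \<open>
  A term moved into a branch of \<open>Case\<close> is weakened by \<open>rename Suc\<close>; if it comes with \<open>n\<close>
  bound variables of its own, by \<open>rename (up_ren n Suc)\<close>.
\<close>

inductive permutation :: "trm \<Rightarrow> trm \<Rightarrow> bool" where
  "permutation (App (Case t t1 t2) s)
     (Case t (App t1 (rename Suc s)) (App t2 (rename Suc s)))"
| "permutation (Pr1 (Case t t1 t2)) (Case t (Pr1 t1) (Pr1 t2))"
| "permutation (Pr2 (Case t t1 t2)) (Case t (Pr2 t1) (Pr2 t2))"
| "permutation (Case (Case t t1 t2) s1 s2)
     (Case t (Case t1 (rename (up_ren 1 Suc) s1) (rename (up_ren 1 Suc) s2))
             (Case t2 (rename (up_ren 1 Suc) s1) (rename (up_ren 1 Suc) s2)))"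
| "n = length ts1 + 1 + length ts2 \<Longrightarrow>
   permutation (B (ts1 @ Case t s1 s2 # ts2) s)
     (Case t (B (map (rename Suc) ts1 @ s1 # map (rename Suc) ts2) (rename (up_ren n Suc) s))
             (B (map (rename Suc) ts1 @ s2 # map (rename Suc) ts2) (rename (up_ren n Suc) s)))"
| "permutation (E (Case t t1 t2)) (Case t (E t1) (E t2))"

inductive bot_conv :: "trm \<Rightarrow> trm \<Rightarrow> bool" where
  "bot_conv (App (E t) s) (E t)"
| "bot_conv (Pr1 (E t)) (E t)"
| "bot_conv (Pr2 (E t)) (E t)"
| "bot_conv (Case (E t) t1 t2) (E t)"
| "bot_conv (E (E t)) (E t)"
| "bot_conv (B (ts1 @ E t # ts2) s) (E t)"

inductive ctx_closure :: "(trm \<Rightarrow> trm \<Rightarrow> bool) \<Rightarrow> trm \<Rightarrow> trm \<Rightarrow> bool"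
  for R :: "trm \<Rightarrow> trm \<Rightarrow> bool" where
  ctx_root: "R t t' \<Longrightarrow> ctx_closure R t t'"
| ctx_Lam: "ctx_closure R t t' \<Longrightarrow> ctx_closure R (Lam t) (Lam t')"
| ctx_App1: "ctx_closure R t t' \<Longrightarrow> ctx_closure R (App t s) (App t' s)"
| ctx_App2: "ctx_closure R s s' \<Longrightarrow> ctx_closure R (App t s) (App t s')"
| ctx_Pair1: "ctx_closure R t t' \<Longrightarrow> ctx_closure R (Pair t s) (Pair t' s)"
| ctx_Pair2: "ctx_closure R s s' \<Longrightarrow> ctx_closure R (Pair t s) (Pair t s')"
| ctx_Pr1: "ctx_closure R t t' \<Longrightarrow> ctx_closure R (Pr1 t) (Pr1 t')"
| ctx_Pr2: "ctx_closure R t t' \<Longrightarrow> ctx_closure R (Pr2 t) (Pr2 t')"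
| ctx_In1: "ctx_closure R t t' \<Longrightarrow> ctx_closure R (In1 t) (In1 t')"
| ctx_In2: "ctx_closure R t t' \<Longrightarrow> ctx_closure R (In2 t) (In2 t')"
| ctx_Case0: "ctx_closure R t t' \<Longrightarrow> ctx_closure R (Case t t1 t2) (Case t' t1 t2)"
| ctx_Case1: "ctx_closure R t1 t1' \<Longrightarrow> ctx_closure R (Case t t1 t2) (Case t t1' t2)"
| ctx_Case2: "ctx_closure R t2 t2' \<Longrightarrow> ctx_closure R (Case t t1 t2) (Case t t1 t2')"
| ctx_E: "ctx_closure R t t' \<Longrightarrow> ctx_closure R (E t) (E t')"
| ctx_B_arg: "ctx_closure R t t' \<Longrightarrow> ctx_closure R (B (ts1 @ t # ts2) s) (B (ts1 @ t' # ts2) s)"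
| ctx_B_body: "ctx_closure R s s' \<Longrightarrow> ctx_closure R (B ts s) (B ts s')"

definition red :: "trm \<Rightarrow> trm \<Rightarrow> bool" where
  "red t u \<longleftrightarrow>
     ctx_closure detour t u \<or> ctx_closure permutation t u \<or> ctx_closure bot_conv t u"

definition strongly_normalizing :: "(trm \<Rightarrow> trm \<Rightarrow> bool) \<Rightarrow> trm \<Rightarrow> bool" where
  "strongly_normalizing R t \<longleftrightarrow> (\<nexists>f :: nat \<Rightarrow> trm. f 0 = t \<and> (\<forall>i. R (f i) (f (Suc i))))"

end

theory Submission
  imports Defs
begin

text \<open>
  Reducibility in the style of Prawitz's strong validity. A reducible term is one all of whose
  reducts are reducible, whose immediate subterms are reducible in the appropriate sense if it is
  an introduction, and whose branches are reducible if it is a \<open>Case\<close>; \<open>B ts s\<close> counts as an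
  introduction with the body \<open>s\<close> as its only relevant part.

  Permutations are handled once and for all: when an elimination is pushed into
  \<open>Case a p q\<close>, the scrutinee \<open>a\<close> remains harmless, because every injection it produces
  already feeds a branch in some reduct of \<open>Case a p q\<close>.

  The arguments of a merged box need not have reducibility at smaller types, so boxes are
  composed without looking at their arguments: variables give boxes \<open>B [t] (Var 0)\<close>, two boxes
  are joined by concatenating arguments and pairing bodies, and a body may be replaced by any
  body whose instances are reducible whenever those of the old one are.
\<close>

subsection \<open>Renaming and substitution\<close>

text \<open>Reducibility is defined by recursion on formulas, and two features of the calculus
  escape that recursion. A merge exposes arguments of types \<open>Nec D\<close> with
  \<open>D\<close> unrelated to the type of the box, and in \<open>Case a p q\<close> the
  disjunction typing \<open>a\<close> is unrelated to the type of the whole term. So neither box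
  arguments nor scrutinees can be required to be reducible at some type. Instead, the new term
  shares them with a term already known to be reducible: whatever happens there in the new term is
  mirrored by a reduction of the known one, and the induction runs over the known one. For the box
  rule the known term has a tuple of all bound variables as its body: if an instance of this tuple
  is reducible, then the bound variables have received reducible terms, which is the hypothesis
  under which the original body is reducible.\<close>

lemma up_ren_comp: "up_ren n \<rho> \<circ> up_ren n \<tau> = up_ren n (\<rho> \<circ> \<tau>)"
  by (auto simp: up_ren_def fun_eq_iff)

lemma up_ren_id: "up_ren n (\<lambda>j. j) = (\<lambda>j. j)"
  by (auto simp: up_ren_def fun_eq_iff)

lemma rename_rename: "rename \<rho> (rename \<tau> t) = rename (\<rho> \<circ> \<tau>) t"
  by (induction \<tau> t arbitrary: \<rho> rule: rename.induct) (auto simp: up_ren_comp)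

lemma rename_id: "rename (\<lambda>j. j) t = t"
  by (induction t) (auto simp: up_ren_id map_idI)

lemma up_sub_up_ren: "up_sub n \<sigma> \<circ> up_ren n \<rho> = up_sub n (\<sigma> \<circ> \<rho>)"
  by (auto simp: up_ren_def up_sub_def fun_eq_iff)

lemma subst_rename: "subst \<sigma> (rename \<rho> t) = subst (\<sigma> \<circ> \<rho>) t"
  by (induction \<rho> t arbitrary: \<sigma> rule: rename.induct) (auto simp: up_sub_up_ren)

lemma rename_up_sub: "rename (up_ren n \<rho>) \<circ> up_sub n \<sigma> = up_sub n (rename \<rho> \<circ> \<sigma>)"
  by (auto simp: up_ren_def up_sub_def fun_eq_iff rename_rename comp_def)

lemma rename_subst: "rename \<rho> (subst \<sigma> t) = subst (rename \<rho> \<circ> \<sigma>) t"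
  by (induction \<sigma> t arbitrary: \<rho> rule: subst.induct) (auto simp: rename_up_sub)

lemma subst_up_sub: "subst (up_sub n \<tau>) \<circ> up_sub n \<sigma> = up_sub n (subst \<tau> \<circ> \<sigma>)"
  by (auto simp: up_sub_def fun_eq_iff rename_subst subst_rename comp_def)

lemma subst_subst: "subst \<tau> (subst \<sigma> t) = subst (subst \<tau> \<circ> \<sigma>) t"
  by (induction \<sigma> t arbitrary: \<tau> rule: subst.induct) (auto simp: subst_up_sub)

lemma up_sub_Var: "up_sub n (\<lambda>j. Var (\<rho> j)) = (\<lambda>j. Var (up_ren n \<rho> j))"
  by (auto simp: up_ren_def up_sub_def fun_eq_iff)

lemma rename_eq_subst: "rename \<rho> t = subst (\<lambda>j. Var (\<rho> j)) t"
  by (induction \<rho> t rule: rename.induct) (auto simp: up_sub_Var)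

lemma subst_Var: "subst Var t = t"
  using rename_eq_subst[of "\<lambda>j. j" t] by (simp add: rename_id)

lemmas compose_simps = subst_subst rename_subst subst_rename rename_rename

lemma subst_subst1:
  "subst \<sigma> (subst1 s t) = subst1 (subst \<sigma> s) (subst (up_sub 1 \<sigma>) t)"
  by (auto simp: subst1_def compose_simps fun_eq_iff up_sub_def comp_def subst_Var
      split: nat.splits intro!: arg_cong2[where f = subst])

lemma subst_weaken:
  "subst (up_sub n \<sigma>) (rename (\<lambda>k. k + n) t) = rename (\<lambda>k. k + n) (subst \<sigma> t)"
  by (auto simp: compose_simps up_sub_def intro!: arg_cong2[where f = subst])

lemma subst_up_weaken:
  "subst (up_sub n (up_sub 1 \<sigma>)) (rename (up_ren n Suc) t)
   = rename (up_ren n Suc) (subst (up_sub n \<sigma>) t)"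
  by (auto simp: compose_simps up_sub_def up_ren_def rename_eq_subst fun_eq_iff
      intro!: arg_cong2[where f = subst])

lemma subst_Suc: "subst (up_sub 1 \<sigma>) (rename Suc t) = rename Suc (subst \<sigma> t)"
  using subst_weaken[of 1] by simp

text \<open>Before the merge \<open>r\<close> lies under \<open>Suc (k + l)\<close> binders and
  \<open>t\<close> under \<open>m\<close>; afterwards there are \<open>k + m + l\<close>. This is
  the index bookkeeping that closes the merge conversion under substitution.\<close>

lemma subst_merge_body:
  "subst (up_sub (k + m + l) \<sigma>) (merge_body k m l t r)
   = merge_body k m l (subst (up_sub m \<sigma>) t) (subst (up_sub (Suc (k + l)) \<sigma>) r)"
  unfolding merge_body_def compose_simps
  apply (rule arg_cong2[where f = subst]; simp?)
  apply (rule ext)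
  apply (auto simp: compose_simps comp_def up_sub_def)
    apply (auto simp: rename_eq_subst compose_simps up_sub_def comp_def intro!: arg_cong2[where f = subst] ext)
  done

subsection \<open>One-step reduction\<close>

text \<open>A single closure of the union of all conversions, so that inversion and induction are
  done once instead of for three closures. It contains \<open>red\<close>, the inclusion used at the
  end.\<close>

abbreviation step :: "trm \<Rightarrow> trm \<Rightarrow> bool" where
  "step \<equiv> ctx_closure (\<lambda>t u. detour t u \<or> permutation t u \<or> bot_conv t u)"

lemma ctx_closure_mono: "ctx_closure R t u \<Longrightarrow> R \<le> R' \<Longrightarrow> ctx_closure R' t u"
  by (induction rule: ctx_closure.induct) (auto intro: ctx_closure.intros)

lemma red_imp_step: "red t u \<Longrightarrow> step t u"
  unfolding red_def by (auto elim!: ctx_closure_mono)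

lemma step_detour: "detour t u \<Longrightarrow> step t u"
  and step_permutation: "permutation t u \<Longrightarrow> step t u"
  and step_bot_conv: "bot_conv t u \<Longrightarrow> step t u"
  by (auto intro: ctx_root)

lemmas step_intros = ctx_closure.intros(2-)
  detour.intros[THEN step_detour] permutation.intros[THEN step_permutation]
  bot_conv.intros[THEN step_bot_conv]

lemma step_cases:
  "step (Var j) u \<Longrightarrow> False"
  "step (Lam t) u \<Longrightarrow> \<exists>t'. u = Lam t' \<and> step t t'"
  "step (Pair t s) u \<Longrightarrow>
    (\<exists>t'. u = Pair t' s \<and> step t t') \<or> (\<exists>s'. u = Pair t s' \<and> step s s')"
  "step (In1 t) u \<Longrightarrow> \<exists>t'. u = In1 t' \<and> step t t'"
  "step (In2 t) u \<Longrightarrow> \<exists>t'. u = In2 t' \<and> step t t'"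
  by (auto elim: ctx_closure.cases detour.cases permutation.cases bot_conv.cases)

lemma step_AppE:
  assumes "step (App t s) u"
  obtains (func) t' where "step t t'" "u = App t' s"
  | (arg) s' where "step s s'" "u = App t s'"
  | (detour) r where "t = Lam r" "u = subst1 s r"
  | (perm) a p q where "t = Case a p q"
      "u = Case a (App p (rename Suc s)) (App q (rename Suc s))"
  | (bot) a where "t = E a" "u = E a"
  using assms
  by (cases rule: ctx_closure.cases) (auto elim: detour.cases permutation.cases bot_conv.cases)

lemma step_Pr1E:
  assumes "step (Pr1 t) u"
  obtains (arg) t' where "step t t'" "u = Pr1 t'"
  | (detour) r where "t = Pair u r"
  | (perm) a p q where "t = Case a p q" "u = Case a (Pr1 p) (Pr1 q)"
  | (bot) a where "t = E a" "u = E a"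
  using assms
  by (cases rule: ctx_closure.cases) (auto elim: detour.cases permutation.cases bot_conv.cases)

lemma step_Pr2E:
  assumes "step (Pr2 t) u"
  obtains (arg) t' where "step t t'" "u = Pr2 t'"
  | (detour) r where "t = Pair r u"
  | (perm) a p q where "t = Case a p q" "u = Case a (Pr2 p) (Pr2 q)"
  | (bot) a where "t = E a" "u = E a"
  using assms
  by (cases rule: ctx_closure.cases) (auto elim: detour.cases permutation.cases bot_conv.cases)

lemma step_EE:
  assumes "step (E t) u"
  obtains (arg) t' where "step t t'" "u = E t'"
  | (perm) a p q where "t = Case a p q" "u = Case a (E p) (E q)"
  | (bot) a where "t = E a" "u = E a"
  using assms
  by (cases rule: ctx_closure.cases) (auto elim: detour.cases permutation.cases bot_conv.cases)

lemma step_CaseE: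
  assumes "step (Case t v w) u"
  obtains (scrut) t' where "step t t'" "u = Case t' v w"
  | (left) v' where "step v v'" "u = Case t v' w"
  | (right) w' where "step w w'" "u = Case t v w'"
  | (inl) a where "t = In1 a" "u = subst1 a v"
  | (inr) a where "t = In2 a" "u = subst1 a w"
  | (perm) a p q where "t = Case a p q"
      "u = Case a (Case p (rename (up_ren 1 Suc) v) (rename (up_ren 1 Suc) w))
                  (Case q (rename (up_ren 1 Suc) v) (rename (up_ren 1 Suc) w))"
  | (bot) a where "t = E a" "u = E a"
  using assms
  by (cases rule: ctx_closure.cases) (auto elim: detour.cases permutation.cases bot_conv.cases)

lemma step_BE:
  assumes "step (B ts r) u"
  obtains (arg) ts1 t t' ts2 where "ts = ts1 @ t # ts2" "step t t'" "u = B (ts1 @ t' # ts2) r"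
  | (body) r' where "step r r'" "u = B ts r'"
  | (merge) ts1 ss t ts2 where "ts = ts1 @ B ss t # ts2"
      "u = B (ts1 @ ss @ ts2) (merge_body (length ts1) (length ss) (length ts2) t r)"
  | (eta) "ts = [u]" "r = Var 0"
  | (perm) ts1 a p q ts2 where "ts = ts1 @ Case a p q # ts2"
      "u = Case a
         (B (map (rename Suc) ts1 @ p # map (rename Suc) ts2) (rename (up_ren (length ts) Suc) r))
         (B (map (rename Suc) ts1 @ q # map (rename Suc) ts2) (rename (up_ren (length ts) Suc) r))"
  | (bot) ts1 a ts2 where "ts = ts1 @ E a # ts2" "u = E a"
  using assms
  apply (cases rule: ctx_closure.cases)
    apply (elim disjE)
      apply (erule detour.cases; simp; blast)
     apply (erule permutation.cases; simp; blast)
    apply (erule bot_conv.cases; simp; blast)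
   apply blast
  apply blast
  done

lemma step_subst: "step t u \<Longrightarrow> step (subst \<sigma> t) (subst \<sigma> u)"
proof (induction arbitrary: \<sigma> rule: ctx_closure.induct)
  case (ctx_root t u)
  then consider "detour t u" | "permutation t u" | "bot_conv t u" by blast
  then show ?case
  proof cases
    case 1
    then show ?thesis
    proof cases
      case (6 ts1 ss t ts2 r)
      then show ?thesis
        using step_intros(21)[of "map (subst \<sigma>) ts1" "map (subst \<sigma>) ss"
            "subst (up_sub (length ss) \<sigma>) t" "map (subst \<sigma>) ts2"
            "subst (up_sub (Suc (length ts1 + length ts2)) \<sigma>) r"]
        by (simp add: add.assoc subst_merge_body[symmetric])
    next
      case (7)
      then show ?thesis by (simp add: up_sub_def step_intros)
    qed (simp_all add: subst_subst1 step_intros)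
  next
    case 2
    then show ?thesis
    proof cases
      case (5 n ts1 ts2 a p q r)
      then show ?thesis
        using step_intros(27)[of n "map (subst \<sigma>) ts1" "map (subst \<sigma>) ts2" "subst \<sigma> a"
            "subst (up_sub 1 \<sigma>) p" "subst (up_sub 1 \<sigma>) q" "subst (up_sub n \<sigma>) r"]
        by (simp add: subst_up_weaken[unfolded One_nat_def] subst_Suc[unfolded One_nat_def] comp_def)
    qed (simp_all add: subst_Suc[unfolded One_nat_def] subst_up_weaken[unfolded One_nat_def] step_intros[unfolded One_nat_def])
  next
    case 3
    then show ?thesis by cases (simp_all add: step_intros)
  qed
qed (simp_all add: step_intros)

lemma step_rename: "step t u \<Longrightarrow> step (rename \<rho> t) (rename \<rho> u)"
  by (simp add: rename_eq_subst step_subst)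

subsection \<open>Renaming reflects reduction\<close>

lemma rename_eq_iffs:
  "rename \<rho> t = Var j \<longleftrightarrow> (\<exists>i. t = Var i \<and> \<rho> i = j)"
  "rename \<rho> t = Lam a \<longleftrightarrow> (\<exists>b. t = Lam b \<and> a = rename (up_ren 1 \<rho>) b)"
  "rename \<rho> t = Pair a b \<longleftrightarrow> (\<exists>a' b'. t = Pair a' b' \<and> a = rename \<rho> a' \<and> b = rename \<rho> b')"
  "rename \<rho> t = In1 a \<longleftrightarrow> (\<exists>a'. t = In1 a' \<and> a = rename \<rho> a')"
  "rename \<rho> t = In2 a \<longleftrightarrow> (\<exists>a'. t = In2 a' \<and> a = rename \<rho> a')"
  "rename \<rho> t = E a \<longleftrightarrow> (\<exists>a'. t = E a' \<and> a = rename \<rho> a')"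
  "rename \<rho> t = Case a p q \<longleftrightarrow> (\<exists>a' p' q'. t = Case a' p' q' \<and> a = rename \<rho> a' \<and>
     p = rename (up_ren 1 \<rho>) p' \<and> q = rename (up_ren 1 \<rho>) q')"
  "rename \<rho> t = B ss a \<longleftrightarrow> (\<exists>ss' a'. t = B ss' a' \<and> ss = map (rename \<rho>) ss' \<and>
     a = rename (up_ren (length ss') \<rho>) a')"
  by (cases t; auto)+

lemmas rename_eq_iffs' = rename_eq_iffs rename_eq_iffs[THEN trans[OF eq_commute]]

lemma rename_subst1: "rename \<rho> (subst1 s t) = subst1 (rename \<rho> s) (rename (up_ren 1 \<rho>) t)"
  by (simp only: rename_eq_subst subst_subst1 up_sub_Var)

lemma rename_merge_body:
  "rename (up_ren (k + m + l) \<rho>) (merge_body k m l t r)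
   = merge_body k m l (rename (up_ren m \<rho>) t) (rename (up_ren (Suc (k + l)) \<rho>) r)"
  by (simp only: rename_eq_subst[of "up_ren _ _"] up_sub_Var[symmetric] subst_merge_body)

lemma rename_Suc: "rename Suc (rename \<rho> t) = rename (up_ren 1 \<rho>) (rename Suc t)"
  by (auto simp: rename_rename up_ren_def intro!: arg_cong2[where f = rename])

lemma rename_up_Suc:
  "rename (up_ren n Suc) (rename (up_ren n \<rho>) t)
   = rename (up_ren n (up_ren 1 \<rho>)) (rename (up_ren n Suc) t)"
  by (auto simp: rename_rename up_ren_def intro!: arg_cong2[where f = rename])

text \<open>Injectivity of \<open>\<rho>\<close> is not assumed: redexes are recognized by
  constructors alone, except \<open>B [t] (Var 0)\<close>, and there \<open>up_ren 1 \<rho>\<close>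
  sends only index 0 to 0. Through this lemma termination and validity pass to renamed
  terms.\<close>

lemma step_rename_inv: "step (rename \<rho> t) u \<Longrightarrow> \<exists>t'. step t t' \<and> u = rename \<rho> t'"
proof (induction t arbitrary: \<rho> u)
  case (Var x)
  then show ?case by (auto dest: step_cases)
next
  case (Lam t)
  obtain a where a: "u = Lam a" "step (rename (up_ren 1 \<rho>) t) a"
    using step_cases(2) Lam.prems by fastforce
  with Lam.IH obtain t' where "step t t'" "a = rename (up_ren 1 \<rho>) t'" by blast
  with a show ?case by (intro exI[of _ "Lam t'"]) (simp add: step_intros)
next
  case (App t s)
  from App.prems[simplified] show ?case
  proof (cases rule: step_AppE)
    case (func t')
    with App.IH(1) obtain y where "step t y" "t' = rename \<rho> y" by fastforce
    with func show ?thesis by (intro exI[of _ "App y s"]) (simp add: step_intros)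
  next
    case (arg s')
    with App.IH(2) obtain y where "step s y" "s' = rename \<rho> y" by fastforce
    with arg show ?thesis by (intro exI[of _ "App t y"]) (simp add: step_intros)
  next
    case (detour r)
    then show ?thesis using step_intros(16) by (fastforce simp: rename_eq_iffs rename_subst1)
  next
    case (perm a p q)
    then obtain a' p' q' where t: "t = Case a' p' q'" "a = rename \<rho> a'"
      "p = rename (up_ren 1 \<rho>) p'" "q = rename (up_ren 1 \<rho>) q'" by (auto simp: rename_eq_iffs)
    have "step (App t s) (Case a' (App p' (rename Suc s)) (App q' (rename Suc s)))"
      unfolding t by (rule step_intros)
    then show ?thesis unfolding perm t
      by (intro exI conjI, assumption) (simp add: rename_Suc[unfolded One_nat_def])
  next
    case (bot a)
    then show ?thesis using step_intros(29) by (fastforce simp: rename_eq_iffs)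
  qed
next
  case (Pair t s)
  from step_cases(3)[OF Pair.prems[simplified]] show ?case
  proof (elim disjE exE conjE)
    fix a assume a: "u = Pair a (rename \<rho> s)" "step (rename \<rho> t) a"
    with Pair.IH(1) obtain y where "step t y" "a = rename \<rho> y" by blast
    with a show ?thesis by (intro exI[of _ "Pair y s"]) (simp add: step_intros)
  next
    fix a assume a: "u = Pair (rename \<rho> t) a" "step (rename \<rho> s) a"
    with Pair.IH(2) obtain y where "step s y" "a = rename \<rho> y" by blast
    with a show ?thesis by (intro exI[of _ "Pair t y"]) (simp add: step_intros)
  qed
next
  case (Pr1 t)
  from Pr1.prems[simplified] show ?case
  proof (cases rule: step_Pr1E)
    case (arg t')
    with Pr1.IH obtain y where "step t y" "t' = rename \<rho> y" by fastforce
    with arg show ?thesis by (intro exI[of _ "Pr1 y"]) (simp add: step_intros)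
  next
    case (detour r)
    then show ?thesis using step_intros(17) by (fastforce simp: rename_eq_iffs)
  next
    case (perm a p q)
    then show ?thesis using step_intros(24) by (fastforce simp: rename_eq_iffs)
  next
    case (bot a)
    then show ?thesis using step_intros(30) by (fastforce simp: rename_eq_iffs)
  qed
next
  case (Pr2 t)
  from Pr2.prems[simplified] show ?case
  proof (cases rule: step_Pr2E)
    case (arg t')
    with Pr2.IH obtain y where "step t y" "t' = rename \<rho> y" by fastforce
    with arg show ?thesis by (intro exI[of _ "Pr2 y"]) (simp add: step_intros)
  next
    case (detour r)
    then show ?thesis using step_intros(18) by (fastforce simp: rename_eq_iffs)
  next
    case (perm a p q)
    then show ?thesis using step_intros(25) by (fastforce simp: rename_eq_iffs)
  next
    case (bot a)
    then show ?thesis using step_intros(31) by (fastforce simp: rename_eq_iffs)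
  qed
next
  case (In1 t)
  obtain a where "u = In1 a" "step (rename \<rho> t) a"
    using step_cases(4) In1.prems by fastforce
  moreover from this(2) In1.IH obtain y where "step t y" "a = rename \<rho> y" by blast
  ultimately show ?case by (intro exI[of _ "In1 y"]) (simp add: step_intros)
next
  case (In2 t)
  obtain a where "u = In2 a" "step (rename \<rho> t) a"
    using step_cases(5) In2.prems by fastforce
  moreover from this(2) In2.IH obtain y where "step t y" "a = rename \<rho> y" by blast
  ultimately show ?case by (intro exI[of _ "In2 y"]) (simp add: step_intros)
next
  case (Case t v w)
  from Case.prems[simplified] show ?case
  proof (cases rule: step_CaseE)
    case (scrut t')
    with Case.IH(1) obtain y where "step t y" "t' = rename \<rho> y" by fastforce
    with scrut show ?thesis by (intro exI[of _ "Case y v w"]) (simp add: step_intros)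
  next
    case (left v')
    with Case.IH(2) obtain y where "step v y" "v' = rename (up_ren 1 \<rho>) y" by fastforce
    with left show ?thesis by (intro exI[of _ "Case t y w"]) (simp add: step_intros)
  next
    case (right w')
    with Case.IH(3) obtain y where "step w y" "w' = rename (up_ren 1 \<rho>) y" by fastforce
    with right show ?thesis by (intro exI[of _ "Case t v y"]) (simp add: step_intros)
  next
    case (inl a)
    then show ?thesis using step_intros(19) by (fastforce simp: rename_eq_iffs rename_subst1)
  next
    case (inr a)
    then show ?thesis using step_intros(20) by (fastforce simp: rename_eq_iffs rename_subst1)
  next
    case (perm a p q)
    then obtain a' p' q' where t: "t = Case a' p' q'" "a = rename \<rho> a'"
      "p = rename (up_ren 1 \<rho>) p'" "q = rename (up_ren 1 \<rho>) q'" by (auto simp: rename_eq_iffs)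
    have "step (Case t v w)
      (Case a' (Case p' (rename (up_ren 1 Suc) v) (rename (up_ren 1 Suc) w))
               (Case q' (rename (up_ren 1 Suc) v) (rename (up_ren 1 Suc) w)))"
      unfolding t by (rule step_intros)
    then show ?thesis unfolding perm t
      by (intro exI conjI, assumption) (simp add: rename_up_Suc[unfolded One_nat_def])
  next
    case (bot a)
    then show ?thesis using step_intros(32) by (fastforce simp: rename_eq_iffs)
  qed
next
  case (E t)
  from E.prems[simplified] show ?case
  proof (cases rule: step_EE)
    case (arg t')
    with E.IH obtain y where "step t y" "t' = rename \<rho> y" by fastforce
    with arg show ?thesis by (intro exI[of _ "E y"]) (simp add: step_intros)
  next
    case (perm a p q)
    then show ?thesis using step_intros(28) by (fastforce simp: rename_eq_iffs)
  next
    case (bot a)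
    then show ?thesis using step_intros(33) by (fastforce simp: rename_eq_iffs)
  qed
next
  case (B ts r)
  from B.prems[simplified] show ?case
  proof (cases rule: step_BE)
    case (arg ts1 x x' ts2)
    then obtain us1 y us2 where ts: "ts = us1 @ y # us2" "ts1 = map (rename \<rho>) us1"
      "x = rename \<rho> y" "ts2 = map (rename \<rho>) us2"
      by (auto simp: map_eq_append_conv map_eq_Cons_conv)
    with arg B.IH(1)[of y \<rho> x'] obtain y' where "step y y'" "x' = rename \<rho> y'" by auto
    with ts arg show ?thesis
      by (intro exI[of _ "B (us1 @ y' # us2) r"]) (simp add: step_intros)
  next
    case (body r')
    with B.IH(2) obtain y where "step r y" "r' = rename (up_ren (length ts) \<rho>) y" by fastforce
    with body show ?thesis by (intro exI[of _ "B ts y"]) (simp add: step_intros)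
  next
    case (merge ts1 ss x ts2)
    then obtain us1 qs y us2 where ts: "ts = us1 @ B qs y # us2" "ts1 = map (rename \<rho>) us1"
      "ss = map (rename \<rho>) qs" "x = rename (up_ren (length qs) \<rho>) y" "ts2 = map (rename \<rho>) us2"
      by (auto simp: map_eq_append_conv map_eq_Cons_conv rename_eq_iffs')
    have "step (B ts r) (B (us1 @ qs @ us2) (merge_body (length us1) (length qs) (length us2) y r))"
      unfolding ts by (rule step_intros)
    then show ?thesis unfolding merge ts
      by (intro exI conjI, assumption) (simp add: rename_merge_body[symmetric] add.assoc)
  next
    case eta
    then show ?thesis
      by (fastforce simp: rename_eq_iffs' map_eq_Cons_conv up_ren_def split: if_splits
          intro: step_intros(22))
  next
    case (perm ts1 a p q ts2)
    then obtain us1 a' p' q' us2 where ts: "ts = us1 @ Case a' p' q' # us2"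
      "ts1 = map (rename \<rho>) us1" "a = rename \<rho> a'"
      "p = rename (up_ren 1 \<rho>) p'" "q = rename (up_ren 1 \<rho>) q'" "ts2 = map (rename \<rho>) us2"
      by (auto simp: map_eq_append_conv map_eq_Cons_conv rename_eq_iffs')
    define n where "n = length us1 + 1 + length us2"
    have "step (B ts r) (Case a'
         (B (map (rename Suc) us1 @ p' # map (rename Suc) us2) (rename (up_ren n Suc) r))
         (B (map (rename Suc) us1 @ q' # map (rename Suc) us2) (rename (up_ren n Suc) r)))"
      unfolding ts by (rule step_intros) (simp add: n_def)
    then show ?thesis unfolding perm ts
      by (intro exI conjI, assumption)
        (simp add: n_def rename_up_Suc[unfolded One_nat_def] rename_Suc[unfolded One_nat_def])
  next
    case (bot ts1 a ts2)
    then show ?thesis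
      by (fastforce simp: map_eq_append_conv map_eq_Cons_conv rename_eq_iffs' intro: step_intros(34))
  qed
qed

subsection \<open>Strong normalization\<close>

inductive sn :: "trm \<Rightarrow> bool" where
  snI: "(\<And>t'. step t t' \<Longrightarrow> sn t') \<Longrightarrow> sn t"

lemma sn_step: "sn t \<Longrightarrow> step t t' \<Longrightarrow> sn t'"
  by (erule sn.cases) blast

lemma sn_rename: "sn t \<Longrightarrow> sn (rename \<rho> t)"
proof (induction rule: sn.induct)
  case (snI t)
  show ?case by (rule sn.snI) (auto dest!: step_rename_inv snI)
qed

lemma sn_imp_strongly_normalizing: "sn t \<Longrightarrow> strongly_normalizing red t"
proof (induction rule: sn.induct)
  case (snI t)
  show ?case
    unfolding strongly_normalizing_def
  proof
    assume "\<exists>f. f 0 = t \<and> (\<forall>i. red (f i) (f (Suc i)))"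
    then obtain f where f: "f 0 = t" "\<And>i. red (f i) (f (Suc i))" by blast
    have "step t (f 1)" using f(2)[of 0] f(1) by (simp add: red_imp_step)
    with snI have "strongly_normalizing red (f 1)" by blast
    moreover have "\<not> strongly_normalizing red (f 1)"
      using f(2) unfolding strongly_normalizing_def
      by (auto intro!: exI[of _ "\<lambda>i. f (Suc i)"])
    ultimately show False by contradiction
  qed
qed

text \<open>Restricted to the positions into which the inductions descend: scrutinee and branches
  after a permutation, the argument of \<open>E\<close> after a bot conversion.\<close>

inductive sub :: "trm \<Rightarrow> trm \<Rightarrow> bool" where
  "sub t (Case t v w)"
| "sub v (Case t v w)"
| "sub w (Case t v w)"
| "sub t (E t)"

lemma sub_step: "sub s t \<Longrightarrow> step s s' \<Longrightarrow> \<exists>t'. step t t' \<and> sub s' t'"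
  by (erule sub.cases) (blast intro: step_intros(10-13) sub.intros)+

lemma subs_step: "sub\<^sup>*\<^sup>* s t \<Longrightarrow> step s s' \<Longrightarrow> \<exists>t'. step t t' \<and> sub\<^sup>*\<^sup>* s' t'"
proof (induction arbitrary: s' rule: converse_rtranclp_induct)
  case base
  then show ?case by blast
next
  case (step y z)
  from sub_step[OF step.hyps(1) step.prems] obtain z' where "step z z'" "sub s' z'"
    by blast
  then show ?case using step.IH by (meson converse_rtranclp_into_rtranclp)
qed

text \<open>
  The well-founded order behind all inductions below. A permutation weakens the terms it moves
  into the branches of a \<open>Case\<close>, so the order has to be blind to renaming.
\<close>

inductive below :: "trm \<Rightarrow> trm \<Rightarrow> bool" where
  below_step_rename: "step t y \<Longrightarrow> below (rename \<rho> y) t"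
| below_sub_rename: "sub y t \<Longrightarrow> below (rename \<rho> y) t"

lemma below_step: "step t y \<Longrightarrow> below y t"
  using below_step_rename[of t y "\<lambda>j. j"] by (simp add: rename_id)

lemma below_sub: "sub y t \<Longrightarrow> below y t"
  using below_sub_rename[of y t "\<lambda>j. j"] by (simp add: rename_id)

lemma sub_rename_inv: "sub x (rename \<rho> t) \<Longrightarrow> \<exists>y \<tau>. sub y t \<and> x = rename \<tau> y"
  by (cases t) (auto elim!: sub.cases intro: sub.intros)

text \<open>Steps and subterms are both reflected by renaming, so renaming a term puts nothing new
  below it.\<close>

lemma below_rename_right:
  assumes "below x (rename \<rho> t)"
  shows "below x t"
  using assms
proof cases
  case (below_step_rename y \<tau>)
  from step_rename_inv[OF this(2)] obtain t' where "step t t'" "y = rename \<rho> t'" by blast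
  then show ?thesis unfolding below_step_rename by (simp add: rename_rename below.intros)
next
  case (below_sub_rename y \<tau>)
  from sub_rename_inv[OF this(2)] obtain z \<rho>' where "sub z t" "y = rename \<rho>' z" by blast
  then show ?thesis unfolding below_sub_rename by (simp add: rename_rename below.intros)
qed

lemma sn_sub: "sn t \<Longrightarrow> sub s t \<Longrightarrow> sn s"
proof (induction arbitrary: s rule: sn.induct)
  case (snI t)
  show ?case
  proof (rule sn.snI)
    fix s' assume "step s s'"
    with sub_step[OF snI.prems] obtain t' where "step t t'" "sub s' t'" by blast
    then show "sn s'" by (rule snI.IH)
  qed
qed

text \<open>Lexicographic in the reductions of \<open>t\<close> and the size of \<open>s\<close>. A
  step inside \<open>s\<close> lifts to a step of the surrounding \<open>t\<close>; a passage to a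
  subterm shrinks \<open>s\<close> and keeps \<open>t\<close>. The renaming is carried along because
  \<open>below\<close> reaches renamed terms.\<close>

lemma sn_imp_accp_below:
  assumes "sn t" "sub\<^sup>*\<^sup>* s t"
  shows "Wellfounded.accp below (rename \<rho> s)"
  using assms
proof (induction arbitrary: s \<rho> rule: sn.induct)
  case (snI t)
  from snI.prems show ?case
  proof (induction "size s" arbitrary: s \<rho> rule: less_induct)
    case less
    show ?case
    proof (rule accpI)
      fix x
      assume "below x (rename \<rho> s)"
      then have "below x s" by (rule below_rename_right)
      then show "Wellfounded.accp below x"
      proof cases
        case (below_step_rename y \<tau>)
        from subs_step[OF less.prems this(2)] obtain t' where "step t t'" "sub\<^sup>*\<^sup>* y t'" by blast
        then show ?thesis unfolding below_step_rename by (rule snI.IH)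
      next
        case (below_sub_rename y \<tau>)
        then have "size y < size s" by (auto elim!: sub.cases)
        moreover have "sub\<^sup>*\<^sup>* y t"
          using below_sub_rename(2) less.prems by (rule converse_rtranclp_into_rtranclp)
        ultimately show ?thesis unfolding below_sub_rename by (rule less.hyps)
      qed
    qed
  qed
qed

lemma belowp_step: "step t y \<Longrightarrow> below\<^sup>+\<^sup>+ y t"
  by (rule tranclp.r_into_trancl, rule below_step)

lemma belowp_sub: "sub y t \<Longrightarrow> below\<^sup>+\<^sup>+ y t"
  by (rule tranclp.r_into_trancl, rule below_sub)

text \<open>The hypothesis is offered for the transitive closure because a permutation followed by a
  passage into a branch takes two moves.\<close>

lemma sn_below_induct [consumes 1, case_names less]:
  assumes "sn t"
    and less: "\<And>t. (\<And>x. below\<^sup>+\<^sup>+ x t \<Longrightarrow> P x) \<Longrightarrow> P t"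
  shows "P t"
proof -
  have "Wellfounded.accp below t"
    using sn_imp_accp_below[OF assms(1), of t "\<lambda>j. j"] by (simp add: rename_id)
  then have "P t \<and> (\<forall>x. below\<^sup>+\<^sup>+ x t \<longrightarrow> P x)"
  proof (induction rule: accp_induct_rule)
    case (1 t)
    have "P x" if "below\<^sup>+\<^sup>+ x t" for x
      using that by cases (use 1 in blast)+
    then show ?case using less by blast
  qed
  then show ?thesis by blast
qed

lemma sn_below: "sn t \<Longrightarrow> below x t \<Longrightarrow> sn x"
  by (erule below.cases) (auto intro: sn_rename sn_step sn_sub)

lemma sn_induct [consumes 1, case_names less]:
  assumes "sn t"
    and less: "\<And>t. sn t \<Longrightarrow> (\<And>x. below\<^sup>+\<^sup>+ x t \<Longrightarrow> P x) \<Longrightarrow> P t"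
  shows "P t"
proof -
  have sn: "sn x" if "below\<^sup>+\<^sup>+ x t" "sn t" for x t
    using that by (induction rule: tranclp_induct) (auto dest: sn_below)
  from assms(1) have "sn t \<longrightarrow> P t"
    by (induction rule: sn_below_induct) (use less sn in blast)
  with assms(1) show ?thesis by blast
qed

subsection \<open>Reducibility\<close>

text \<open>Recursion over formulas enters only through the parameter \<open>I\<close>; the branches
  of a \<open>Case\<close> have the type of the whole term, so they belong to this induction. The
  scrutinee has a foreign type and gets no clause.\<close>

inductive valid :: "(trm \<Rightarrow> bool) \<Rightarrow> trm \<Rightarrow> bool" for I where
  validI: "(\<And>t'. step t t' \<Longrightarrow> valid I t') \<Longrightarrow> I t \<Longrightarrow>
    (\<And>u p q. t = Case u p q \<Longrightarrow> valid I p) \<Longrightarrow> (\<And>u p q. t = Case u p q \<Longrightarrow> valid I q) \<Longrightarrow> valid I t"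

lemma valid_step: "valid I t \<Longrightarrow> step t t' \<Longrightarrow> valid I t'"
  and valid_intro: "valid I t \<Longrightarrow> I t"
  and valid_Case1: "valid I (Case u p q) \<Longrightarrow> valid I p"
  and valid_Case2: "valid I (Case u p q) \<Longrightarrow> valid I q"
  by (auto elim: valid.cases)

lemma valid_sn: "valid I t \<Longrightarrow> sn t"
  by (induction rule: valid.induct) (auto intro: snI)

text \<open>
  \<open>good_scrutinee S v w t\<close>: whatever injection \<open>t\<close> reduces to, also inside branches of
  \<open>Case\<close>, selects a contractum of \<open>Case t v w\<close> lying in \<open>S\<close>.
\<close>

inductive good_scrutinee :: "(trm \<Rightarrow> bool) \<Rightarrow> trm \<Rightarrow> trm \<Rightarrow> trm \<Rightarrow> bool" for S where
  good_scrutineeI: "(\<And>t'. step t t' \<Longrightarrow> good_scrutinee S v w t') \<Longrightarrow>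
    (\<And>a. t = In1 a \<Longrightarrow> S (subst1 a v)) \<Longrightarrow> (\<And>a. t = In2 a \<Longrightarrow> S (subst1 a w)) \<Longrightarrow>
    (\<And>u p q. t = Case u p q \<Longrightarrow>
       good_scrutinee S (rename (up_ren 1 Suc) v) (rename (up_ren 1 Suc) w) p) \<Longrightarrow>
    (\<And>u p q. t = Case u p q \<Longrightarrow>
       good_scrutinee S (rename (up_ren 1 Suc) v) (rename (up_ren 1 Suc) w) q) \<Longrightarrow> good_scrutinee S v w t"

lemma good_scrutinee_step: "good_scrutinee S v w t \<Longrightarrow> step t t' \<Longrightarrow> good_scrutinee S v w t'"
  and good_scrutinee_In1: "good_scrutinee S v w (In1 a) \<Longrightarrow> S (subst1 a v)"
  and good_scrutinee_In2: "good_scrutinee S v w (In2 a) \<Longrightarrow> S (subst1 a w)"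
  and good_scrutinee_Case1: "good_scrutinee S v w (Case u p q) \<Longrightarrow>
     good_scrutinee S (rename (up_ren 1 Suc) v) (rename (up_ren 1 Suc) w) p"
  and good_scrutinee_Case2: "good_scrutinee S v w (Case u p q) \<Longrightarrow>
     good_scrutinee S (rename (up_ren 1 Suc) v) (rename (up_ren 1 Suc) w) q"
  by (auto elim: good_scrutinee.cases)

lemma good_scrutinee_sn: "good_scrutinee S v w t \<Longrightarrow> sn t"
  by (induction rule: good_scrutinee.induct) (auto intro: snI)

lemma step_subst1: "step t t' \<Longrightarrow> step (subst1 a t) (subst1 a t')"
  unfolding subst1_def by (rule step_subst)

text \<open>Serves reductions inside a branch of \<open>Case\<close>; the equalities let the other
  branch stay put. Renaming preserves both disjuncts, so the relation survives the weakening at each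
  \<open>Case\<close> crossed.\<close>

lemma good_scrutinee_branch_step:
  assumes "good_scrutinee S v w t" "v' = v \<or> step v v'" "w' = w \<or> step w w'"
    and S: "\<And>t t'. S t \<Longrightarrow> step t t' \<Longrightarrow> S t'"
  shows "good_scrutinee S v' w' t"
  using assms(1-3)
proof (induction arbitrary: v' w' rule: good_scrutinee.induct)
  case (good_scrutineeI t v w)
  show ?case
  proof (rule good_scrutinee.good_scrutineeI)
    show "S (subst1 a v')" if "t = In1 a" for a
      using good_scrutineeI.hyps(2)[OF that] good_scrutineeI.prems S step_subst1 by blast
    show "S (subst1 a w')" if "t = In2 a" for a
      using good_scrutineeI.hyps(3)[OF that] good_scrutineeI.prems S step_subst1 by blast
    show "good_scrutinee S v' w' t'" if "step t t'" for t'
      by (rule good_scrutineeI.IH(1)[OF that good_scrutineeI.prems])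
    have up: "rename (up_ren 1 Suc) v' = rename (up_ren 1 Suc) v \<or>
        step (rename (up_ren 1 Suc) v) (rename (up_ren 1 Suc) v')"
      "rename (up_ren 1 Suc) w' = rename (up_ren 1 Suc) w \<or>
        step (rename (up_ren 1 Suc) w) (rename (up_ren 1 Suc) w')"
      using good_scrutineeI.prems step_rename by blast+
    show "good_scrutinee S (rename (up_ren 1 Suc) v') (rename (up_ren 1 Suc) w') p" if "t = Case u p q" for u p q
      by (rule good_scrutineeI.IH(2)[OF that up])
    show "good_scrutinee S (rename (up_ren 1 Suc) v') (rename (up_ren 1 Suc) w') q" if "t = Case u p q" for u p q
      by (rule good_scrutineeI.IH(3)[OF that up])
  qed
qed

lemma good_scrutinee_of_valid:
  assumes "valid J t"
    and "\<And>\<rho> a. J (In1 a) \<Longrightarrow> S (subst1 a (rename (up_ren 1 \<rho>) v))"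
    and "\<And>\<rho> a. J (In2 a) \<Longrightarrow> S (subst1 a (rename (up_ren 1 \<rho>) w))"
  shows "good_scrutinee S v w t"
proof -
  \<comment> \<open>Generalized over \<open>\<rho>\<close>, since each \<open>Case\<close> crossed
    adds one weakening to \<open>v\<close> and \<open>w\<close>.\<close>
  have "good_scrutinee S (rename (up_ren 1 \<rho>) v) (rename (up_ren 1 \<rho>) w) t" for \<rho>
    using assms(1)
  proof (induction arbitrary: \<rho> rule: valid.induct)
    case (validI t)
    show ?case
    proof (rule good_scrutinee.good_scrutineeI)
    qed (use validI assms(2,3) in \<open>auto simp: rename_rename up_ren_comp\<close>)
  qed
  from this[of "\<lambda>j. j"] show ?thesis by (simp add: up_ren_id rename_id)
qed

text \<open>
  \<open>G \<rho>\<close> is an elimination frame whose parameters are renamed by \<open>\<rho>\<close>, \<open>\<Phi> \<rho>\<close> a set of terms that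
  may fill it, and \<open>H \<rho> t\<close> the term that decreases in the surrounding induction. In the case
  \<open>u = Case u1 p1 q1\<close> the permutation of \<open>Case u p q\<close> puts \<open>Case p1 p q\<close> into a branch, to which
  the induction hypothesis applies.
\<close>

lemma good_scrutinee_of_Case:
  assumes \<Phi>_step: "\<And>\<rho> t t'. \<Phi> \<rho> t \<Longrightarrow> step t t' \<Longrightarrow> \<Phi> \<rho> t' \<and> below\<^sup>+\<^sup>+ (H \<rho> t') (H \<rho> t)"
    and \<Phi>_branch: "\<And>\<rho> u p q. \<Phi> \<rho> (Case u p q) \<Longrightarrow> \<Phi> (Suc \<circ> \<rho>) p \<and> \<Phi> (Suc \<circ> \<rho>) q \<and>
      below\<^sup>+\<^sup>+ (H (Suc \<circ> \<rho>) p) (H \<rho> (Case u p q)) \<and> below\<^sup>+\<^sup>+ (H (Suc \<circ> \<rho>) q) (H \<rho> (Case u p q))"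
    and \<Phi>_sn: "\<And>\<rho> t. \<Phi> \<rho> t \<Longrightarrow> sn t"
    and G_subst: "\<And>\<rho> a t. subst1 a (G (Suc \<circ> \<rho>) t) = G \<rho> (subst1 a t)"
    and G_rename: "\<And>\<rho> t. rename (up_ren 1 Suc) (G (Suc \<circ> \<rho>) t)
      = G (Suc \<circ> (Suc \<circ> \<rho>)) (rename (up_ren 1 Suc) t)"
    and "\<Phi> \<rho> (Case u p q)"
    and "\<And>\<rho>' t'. \<Phi> \<rho>' t' \<Longrightarrow> below\<^sup>+\<^sup>+ (H \<rho>' t') (H \<rho> (Case u p q)) \<Longrightarrow> S (G \<rho>' t')"
  shows "good_scrutinee S (G (Suc \<circ> \<rho>) p) (G (Suc \<circ> \<rho>) q) u"
proof -
  define t where "t = Case u p q"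
  have "sn t" using assms(6) \<Phi>_sn t_def by blast
  then show ?thesis using t_def assms(6,7)
  proof (induction arbitrary: \<rho> u p q rule: sn_below_induct)
    case (less t)
    note \<Phi> = less.prems(2)[folded less.prems(1)]
    note IH = less.IH[OF _ refl _ less.prems(3)]
    have S: "S (G \<rho> t')" if "step t t'" for t'
      using less.prems \<Phi>_step[OF \<Phi> that] by blast
    show ?case
    proof (rule good_scrutinee.good_scrutineeI)
      fix u' assume "step u u'"
      then have *: "step t (Case u' p q)" unfolding less.prems by (rule step_intros)
      note ** = \<Phi>_step[OF \<Phi> *, unfolded less.prems(1)]
      show "good_scrutinee S (G (Suc \<circ> \<rho>) p) (G (Suc \<circ> \<rho>) q) u'"
      proof (rule IH[OF belowp_step[OF *]])
        show "\<Phi> \<rho> (Case u' p q)" using ** by blast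
        fix \<rho>' t' assume "below\<^sup>+\<^sup>+ (H \<rho>' t') (H \<rho> (Case u' p q))"
        then show "below\<^sup>+\<^sup>+ (H \<rho>' t') (H \<rho> (Case u p q))"
          using ** tranclp_trans[of below] by blast
      qed
    next
      \<comment> \<open>The contractum \<open>subst1 a p\<close> is a reduct of \<open>t\<close>, so
        \<open>S\<close> holds of it inside the frame; by \<open>G_subst\<close>, framing and
        contracting commute.\<close>
      fix a assume "u = In1 a"
      then have "step t (subst1 a p)" unfolding less.prems by (auto intro: step_intros)
      then show "S (subst1 a (G (Suc \<circ> \<rho>) p))" using S by (auto simp: G_subst)
    next
      fix a assume "u = In2 a"
      then have "step t (subst1 a q)" unfolding less.prems by (auto intro: step_intros)
      then show "S (subst1 a (G (Suc \<circ> \<rho>) q))" using S by (auto simp: G_subst)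
    next
      fix u1 p1 q1 assume u: "u = Case u1 p1 q1"
      let ?p = "Case p1 (rename (up_ren 1 Suc) p) (rename (up_ren 1 Suc) q)"
      let ?q = "Case q1 (rename (up_ren 1 Suc) p) (rename (up_ren 1 Suc) q)"
      have *: "step t (Case u1 ?p ?q)" unfolding less.prems u by (rule step_intros)
      note ** = \<Phi>_step[OF \<Phi> *, unfolded less.prems(1)]
      \<comment> \<open>Permute first, then enter a branch: both moves decrease \<open>H\<close>, so
        the claim for the branch inherits its hypothesis about \<open>S\<close> by
        transitivity.\<close>
      note *** = \<Phi>_branch[OF conjunct1[OF **]]
      have below: "below\<^sup>+\<^sup>+ ?p t" "below\<^sup>+\<^sup>+ ?q t"
        using belowp_step[OF *] belowp_sub sub.intros(2,3) tranclp_trans[of below] by blast+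
      show "good_scrutinee S (rename (up_ren 1 Suc) (G (Suc \<circ> \<rho>) p))
          (rename (up_ren 1 Suc) (G (Suc \<circ> \<rho>) q)) p1"
        unfolding G_rename
      proof (rule IH[OF below(1)])
        show "\<Phi> (Suc \<circ> \<rho>) ?p" using *** by blast
        fix \<rho>' t' assume "below\<^sup>+\<^sup>+ (H \<rho>' t') (H (Suc \<circ> \<rho>) ?p)"
        then show "below\<^sup>+\<^sup>+ (H \<rho>' t') (H \<rho> (Case u p q))"
          using ** *** tranclp_trans[of below] by blast
      qed
      show "good_scrutinee S (rename (up_ren 1 Suc) (G (Suc \<circ> \<rho>) p))
          (rename (up_ren 1 Suc) (G (Suc \<circ> \<rho>) q)) q1"
        unfolding G_rename
      proof (rule IH[OF below(2)])
        show "\<Phi> (Suc \<circ> \<rho>) ?q" using *** by blast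
        fix \<rho>' t' assume "below\<^sup>+\<^sup>+ (H \<rho>' t') (H (Suc \<circ> \<rho>) ?q)"
        then show "below\<^sup>+\<^sup>+ (H \<rho>' t') (H \<rho> (Case u p q))"
          using ** *** tranclp_trans[of below] by blast
      qed
    qed
  qed
qed

section \<open>Candidates and their closure under \<open>E\<close> and \<open>Case\<close>\<close>

fun is_intro :: "trm \<Rightarrow> bool" where
  "is_intro (Lam t) = True"
| "is_intro (Pair t s) = True"
| "is_intro (In1 t) = True"
| "is_intro (In2 t) = True"
| "is_intro (B ts s) = True"
| "is_intro _ = False"

lemma subst1_rename_Suc: "subst1 a (rename Suc t) = t"
  by (simp add: subst1_def compose_simps comp_def subst_Var)

lemma subst1_rename_Suc_comp: "subst1 a (rename (Suc \<circ> \<rho>) t) = rename \<rho> t"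
  by (metis rename_rename subst1_rename_Suc)

lemma rename_up_1_Suc_comp:
  "rename (up_ren 1 Suc) (rename (Suc \<circ> \<rho>) t) = rename (Suc \<circ> (Suc \<circ> \<rho>)) t"
  by (auto simp: rename_rename up_ren_def intro!: arg_cong2[where f = rename])

lemma subst_up_rename_up_Suc_comp:
  "subst (up_sub n (\<lambda>j. case j of 0 \<Rightarrow> a | Suc k \<Rightarrow> Var k)) (rename (up_ren n (Suc \<circ> \<rho>)) t)
   = rename (up_ren n \<rho>) t"
  by (auto simp: subst_rename rename_eq_subst[of "up_ren n \<rho>"] up_sub_def up_ren_def
      intro!: arg_cong2[where f = subst])

lemma rename_up_up_Suc_comp:
  "rename (up_ren n (up_ren (Suc 0) Suc)) (rename (up_ren n (Suc \<circ> \<rho>)) t)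
   = rename (up_ren n (Suc \<circ> (Suc \<circ> \<rho>))) t"
  by (auto simp: rename_rename up_ren_def intro!: arg_cong2[where f = rename])

locale candidate =
  fixes I :: "trm \<Rightarrow> bool"
  assumes I_rename: "I t \<Longrightarrow> I (rename \<rho> t)"
    and I_neutral: "\<not> is_intro t \<Longrightarrow> I t"
begin

lemma rename_closed: "valid I t \<Longrightarrow> valid I (rename \<rho> t)"
proof (induction arbitrary: \<rho> rule: valid.induct)
  case (validI t)
  show ?case
    by (rule valid.validI)
      (use validI in \<open>auto dest!: step_rename_inv simp: I_rename rename_eq_iffs\<close>)
qed

lemma valid_Var: "valid I (Var j)"
  by (rule valid.validI) (auto dest: step_cases intro: I_neutral)

text \<open>
  The two claims need each other: scrutinees may become \<open>E a\<close>, and \<open>E\<close> permutes with \<open>Case\<close>.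
\<close>

lemma valid_E_and_Case:
  "sn t \<Longrightarrow> valid I (E t) \<and> (\<forall>v w. good_scrutinee (valid I) v w t \<longrightarrow> valid I v \<longrightarrow> valid I w \<longrightarrow> valid I (Case t v w))"
proof (induction "t" rule: sn_induct)
  case (less t)
  have IH_E: "valid I (E x)" if "below\<^sup>+\<^sup>+ x t" for x
    using less that by blast
  have IH_Case: "valid I (Case x v w)"
    if "below\<^sup>+\<^sup>+ x t" "good_scrutinee (valid I) v w x" "valid I v" "valid I w" for x v w
    using less that by blast
  have "valid I (E t)"
  proof (rule valid.validI)
    fix x assume "step (E t) x"
    then show "valid I x"
    proof (cases rule: step_EE)
      case (arg t')
      then show ?thesis using IH_E belowp_step by blast
    next
      case (perm a p q)
      have below: "below\<^sup>+\<^sup>+ a t" "below\<^sup>+\<^sup>+ p t" "below\<^sup>+\<^sup>+ q t"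
        unfolding perm by (auto intro: belowp_sub sub.intros)
      \<comment> \<open>The frame is \<open>E\<close>; any strongly normalizing term may fill it,
        and the filling is its own measure.\<close>
      have "good_scrutinee (valid I) (E p) (E q) a"
        using less.hyps IH_E unfolding perm
        by (intro good_scrutinee_of_Case[where \<Phi> = "\<lambda>_. sn" and G = "\<lambda>_. E" and H = "\<lambda>_ x. x"])
          (auto simp: subst1_def intro: sn_step sn_sub belowp_step belowp_sub sub.intros)
      with below show ?thesis unfolding perm(2) by (intro IH_Case IH_E)
    next
      case (bot a)
      then show ?thesis using IH_E belowp_sub sub.intros by blast
    qed
  qed (auto intro: I_neutral)
  \<comment> \<open>Lexicographic in \<open>t\<close>, \<open>v\<close>, \<open>w\<close>. Goodness
    of \<open>t\<close> mentions the branches, so it stays a premise of both inner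
    inductions.\<close>
  moreover have "valid I (Case t v w)" if "good_scrutinee (valid I) v w t" "valid I v" "valid I w" for v w
    using that(2,3,1)
  proof (induction arbitrary: w rule: valid.induct)
    case outer: (validI v)
    from outer.prems show ?case
    proof (induction rule: valid.induct)
      case inner: (validI w)
      have v: "valid I v" using outer by (blast intro: valid.validI)
      have w: "valid I w" using inner by (blast intro: valid.validI)
      show ?case
      proof (rule valid.validI)
        fix x assume "step (Case t v w) x"
        then show "valid I x"
        proof (cases rule: step_CaseE)
          case (scrut t')
          then show ?thesis
            using IH_Case[OF belowp_step] good_scrutinee_step[OF inner.prems] v w by blast
        next
          case (left v')
          then show ?thesis
            using outer.IH(1)[OF _ w] good_scrutinee_branch_step[OF inner.prems] valid_step by blast
        next
          case (right w')
          then show ?thesis using inner good_scrutinee_branch_step[OF inner.prems] valid_step by blast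
        next
          case (inl a)
          then show ?thesis using inner.prems good_scrutinee_In1 by blast
        next
          case (inr a)
          then show ?thesis using inner.prems good_scrutinee_In2 by blast
        next
          case (perm a p q)
          let ?v = "rename (up_ren 1 Suc) v" and ?w = "rename (up_ren 1 Suc) w"
          \<comment> \<open>The frame is the outer \<open>Case\<close>; a term may fill it if it is
            a good scrutinee for the branches, which is the form that \<open>IH_Case\<close>
            accepts.\<close>
          let ?\<Phi> = "\<lambda>\<rho>. good_scrutinee (valid I) (rename (up_ren 1 \<rho>) v) (rename (up_ren 1 \<rho>) w)"
          let ?G = "\<lambda>\<rho> x. Case x (rename (up_ren 1 \<rho>) v) (rename (up_ren 1 \<rho>) w)"
          have below: "below\<^sup>+\<^sup>+ a t" "below\<^sup>+\<^sup>+ p t" "below\<^sup>+\<^sup>+ q t"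
            unfolding perm by (auto intro: belowp_sub sub.intros)
          have G: "valid I (?G \<rho> x)" if "?\<Phi> \<rho> x" "below\<^sup>+\<^sup>+ x t" for \<rho> x
            using IH_Case that v w rename_closed by blast
          have "good_scrutinee (valid I) (?G (Suc \<circ> (\<lambda>j. j)) p) (?G (Suc \<circ> (\<lambda>j. j)) q) a"
          proof (rule good_scrutinee_of_Case[where G = ?G and \<rho> = "\<lambda>j. j" and \<Phi> = ?\<Phi>
                and H = "\<lambda>_ x. x"])
            show "?\<Phi> (\<lambda>j. j) (Case a p q)"
              using inner.prems perm by (simp add: up_ren_id rename_id)
          next
            fix \<rho> u p q
            assume "?\<Phi> \<rho> (Case u p q)"
            then show "?\<Phi> (Suc \<circ> \<rho>) p \<and> ?\<Phi> (Suc \<circ> \<rho>) q \<and>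
                below\<^sup>+\<^sup>+ p (Case u p q) \<and> below\<^sup>+\<^sup>+ q (Case u p q)"
              using good_scrutinee_Case1 good_scrutinee_Case2
              by (fastforce simp: rename_rename up_ren_comp intro: belowp_sub sub.intros)
          qed (use G perm in \<open>auto simp: subst1_def rename_up_up_Suc_comp
              subst_up_rename_up_Suc_comp[of "Suc 0"] intro: good_scrutinee_sn good_scrutinee_step belowp_step\<close>)
          then have "good_scrutinee (valid I) (Case p ?v ?w) (Case q ?v ?w) a" by (simp add: comp_def)
          moreover have "valid I (Case p ?v ?w)" "valid I (Case q ?v ?w)"
            using inner.prems below v w unfolding perm
            by (auto intro!: IH_Case rename_closed dest: good_scrutinee_Case1 good_scrutinee_Case2 simp: perm)
          ultimately show ?thesis unfolding perm(2) using IH_Case below by blast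
        next
          case (bot a)
          then show ?thesis using IH_E belowp_sub sub.intros by blast
        qed
      qed (use v w in \<open>auto intro: I_neutral\<close>)
    qed
  qed
  ultimately show ?case by blast
qed

lemma valid_E: "sn t \<Longrightarrow> valid I (E t)"
  and valid_Case: "good_scrutinee (valid I) v w t \<Longrightarrow> valid I v \<Longrightarrow> valid I w \<Longrightarrow> valid I (Case t v w)"
  using valid_E_and_Case good_scrutinee_sn by blast+

text \<open>The permutation case shared by application, the projections and
  \<open>B [t] (Var 0)\<close>: fillings are valid at another condition \<open>J\<close> and serve
  as their own measure.\<close>

lemma valid_commute:
  assumes "valid J (Case a p q)"
    and "\<And>\<rho> x. valid J x \<Longrightarrow> below\<^sup>+\<^sup>+ x (Case a p q) \<Longrightarrow> valid I (G \<rho> x)"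
    and "\<And>\<rho> a t. subst1 a (G (Suc \<circ> \<rho>) t) = G \<rho> (subst1 a t)"
    and "\<And>\<rho> t. rename (up_ren 1 Suc) (G (Suc \<circ> \<rho>) t)
      = G (Suc \<circ> (Suc \<circ> \<rho>)) (rename (up_ren 1 Suc) t)"
  shows "valid I (Case a (G Suc p) (G Suc q))"
proof -
  have "good_scrutinee (valid I) (G (Suc \<circ> (\<lambda>j. j)) p) (G (Suc \<circ> (\<lambda>j. j)) q) a"
    using assms
    by (intro good_scrutinee_of_Case[where \<Phi> = "\<lambda>_. valid J" and H = "\<lambda>_ x. x" and G = G])
      (auto intro: valid_step valid_Case1 valid_Case2 valid_sn belowp_step belowp_sub sub.intros)
  moreover have "valid I (G Suc p)" "valid I (G Suc q)"
    by (rule assms(2); use assms(1) in \<open>blast intro: valid_Case1 valid_Case2 belowp_sub sub.intros\<close>)+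
  ultimately show ?thesis by (auto simp: comp_def intro: valid_Case)
qed

end

subsection \<open>Reducible terms of a type\<close>

text \<open>The renaming in the \<open>Imp\<close> clause is of Kripke kind: arguments may live in
  another scope, and the clause becomes closed under renaming. Terms being untyped, each clause is
  vacuous for introductions of other shapes.\<close>

primrec intro_cond :: "'a form \<Rightarrow> trm \<Rightarrow> bool" where
  "intro_cond (Atom a) = (\<lambda>_. True)"
| "intro_cond Bot = (\<lambda>_. True)"
| "intro_cond (And A C) = (\<lambda>t. \<forall>u v. t = Pair u v \<longrightarrow> valid (intro_cond A) u \<and> valid (intro_cond C) v)"
| "intro_cond (Or A C) = (\<lambda>t. (\<forall>u. t = In1 u \<longrightarrow> valid (intro_cond A) u) \<and> (\<forall>u. t = In2 u \<longrightarrow> valid (intro_cond C) u))"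
| "intro_cond (Imp A C) = (\<lambda>t. \<forall>u. t = Lam u \<longrightarrow>
     (\<forall>\<rho> a. valid (intro_cond A) a \<longrightarrow> valid (intro_cond C) (subst1 a (rename (up_ren 1 \<rho>) u))))"
| "intro_cond (Nec A) = (\<lambda>t. \<forall>ss u. t = B ss u \<longrightarrow> valid (intro_cond A) u)"

abbreviation reducible :: "'a form \<Rightarrow> trm \<Rightarrow> bool" where
  "reducible A \<equiv> valid (intro_cond A)"

lemma candidate_intro_cond: "candidate (intro_cond A)"
proof (induction A)
  case (And A C)
  then interpret A: candidate "intro_cond A" + C: candidate "intro_cond C" .
  show ?case
    by standard (auto simp: rename_eq_iffs A.rename_closed C.rename_closed)
next
  case (Or A C)
  then interpret A: candidate "intro_cond A" + C: candidate "intro_cond C" .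
  show ?case
    by standard (auto simp: rename_eq_iffs A.rename_closed C.rename_closed)
next
  case (Imp A C)
  show ?case
    by standard (auto simp: rename_eq_iffs rename_rename up_ren_comp)
next
  case (Nec A)
  then interpret candidate "intro_cond A" .
  show ?case
    by standard (auto simp: rename_eq_iffs rename_closed)
qed (standard; simp)+

lemma intro_cond_iffs [simp]:
  "intro_cond (And A C) (Pair t s) \<longleftrightarrow> reducible A t \<and> reducible C s"
  "intro_cond (Or A C) (In1 t) \<longleftrightarrow> reducible A t"
  "intro_cond (Or A C) (In2 t) \<longleftrightarrow> reducible C t"
  "intro_cond (Imp A C) (Lam t) \<longleftrightarrow>
     (\<forall>\<rho> a. reducible A a \<longrightarrow> reducible C (subst1 a (rename (up_ren 1 \<rho>) t)))"
  "intro_cond (Nec A) (B ts t) \<longleftrightarrow> reducible A t"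
  by auto

declare intro_cond.simps [simp del]

lemmas reducible_rename = candidate.rename_closed[OF candidate_intro_cond]
  and reducible_Var = candidate.valid_Var[OF candidate_intro_cond]
  and reducible_E = candidate.valid_E[OF candidate_intro_cond]
  and reducible_commute = candidate.valid_commute[OF candidate_intro_cond]
  and intro_cond_neutral = candidate.I_neutral[OF candidate_intro_cond]

section \<open>Introductions preserve reducibility\<close>

lemma reducible_Pair: "reducible A t \<Longrightarrow> reducible C s \<Longrightarrow> reducible (And A C) (Pair t s)"
proof (induction arbitrary: s rule: valid.induct)
  case outer: (validI t)
  from outer.prems show ?case
  proof (induction rule: valid.induct)
    case inner: (validI s)
    have t: "reducible A t" using outer by (blast intro: valid.validI)
    have s: "reducible C s" using inner by (blast intro: valid.validI)
    show ?case
    proof (rule valid.validI)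
      fix x assume "step (Pair t s) x"
      then show "reducible (And A C) x"
        using step_cases(3) outer.IH(1)[OF _ s] inner.IH(1) by blast
    qed (use t s in auto)
  qed
qed

lemma reducible_In1: "reducible A t \<Longrightarrow> reducible (Or A C) (In1 t)"
proof (induction rule: valid.induct)
  case (validI t)
  then have t: "reducible A t" by (blast intro: valid.validI)
  show ?case
  proof (rule valid.validI)
    fix x assume "step (In1 t) x"
    then show "reducible (Or A C) x" using step_cases(4) validI.IH(1) by blast
  qed (use t in auto)
qed

lemma reducible_In2: "reducible C t \<Longrightarrow> reducible (Or A C) (In2 t)"
proof (induction rule: valid.induct)
  case (validI t)
  then have t: "reducible C t" by (blast intro: valid.validI)
  show ?case
  proof (rule valid.validI)
    fix x assume "step (In2 t) x"
    then show "reducible (Or A C) x" using step_cases(5) validI.IH(1) by blast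
  qed (use t in auto)
qed

text \<open>Instances at reducible arguments include the one at a variable; this identity turns that
  instance back into the open body, which is thereby reducible itself.\<close>

lemma subst1_Var_0_rename: "subst1 (Var 0) (rename (up_ren 1 Suc) t) = t"
proof -
  have "(\<lambda>j. case up_ren 1 Suc j of 0 \<Rightarrow> Var 0 | Suc k \<Rightarrow> Var k) = Var"
    by (auto simp: up_ren_def fun_eq_iff split: nat.splits)
  then show ?thesis by (simp add: subst1_def subst_rename comp_def subst_Var)
qed

lemma reducible_Lam:
  assumes "\<And>\<rho> a. reducible A a \<Longrightarrow> reducible C (subst1 a (rename (up_ren 1 \<rho>) t))"
  shows "reducible (Imp A C) (Lam t)"
proof -
  have "reducible C t"
    using assms[OF reducible_Var, of 0 Suc] by (simp add: subst1_Var_0_rename[unfolded One_nat_def])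
  then show ?thesis
    using assms
  proof (induction rule: valid.induct)
    case (validI t)
    show ?case
    proof (rule valid.validI)
      fix x assume "step (Lam t) x"
      then obtain t' where t': "x = Lam t'" "step t t'" using step_cases(2) by blast
      show "reducible (Imp A C) x"
        unfolding t' by (rule validI.IH(1)[OF t'(2)])
          (use validI.prems t'(2) valid_step step_rename step_subst1 in blast)
    qed (use validI.prems in auto)
  qed
qed

section \<open>Eliminations preserve reducibility\<close>

lemma reducible_App:
  assumes "reducible (Imp A C) t" "reducible A s"
  shows "reducible C (App t s)"
  using valid_sn[OF assms(1)] assms
proof (induction arbitrary: s rule: sn_induct)
  case (less t)
  from less.prems(2,1) show ?case
  proof (induction rule: valid.induct)
    case (validI s)
    have s: "reducible A s" using validI by (blast intro: valid.validI)
    show ?case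
    proof (rule valid.validI)
      fix x assume "step (App t s) x"
      then show "reducible C x"
      proof (cases rule: step_AppE)
        case (func t')
        then show ?thesis using less.IH[OF belowp_step _ s] valid_step[OF validI.prems] by blast
      next
        case (arg s')
        then show ?thesis using validI by blast
      next
        case (detour r)
        then have "intro_cond (Imp A C) (Lam r)" using valid_intro[OF validI.prems] by simp
        with s have "reducible C (subst1 s (rename (up_ren 1 (\<lambda>j. j)) r))" by auto
        then show ?thesis unfolding detour(2) up_ren_id rename_id .
      next
        case (perm a p q)
        have IH: "reducible C (App y (rename \<rho> s))"
          if "reducible (Imp A C) y" "below\<^sup>+\<^sup>+ y t" for y \<rho>
          using less.IH that s reducible_rename by blast
        show ?thesis
          unfolding perm(2)
          by (rule reducible_commute[where J = "intro_cond (Imp A C)"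
                and G = "\<lambda>\<rho> x. App x (rename \<rho> s)"])
            (use validI.prems IH perm in
              \<open>auto simp: subst1_def subst_up_rename_up_Suc_comp[of 0, simplified]
                 rename_up_1_Suc_comp[unfolded One_nat_def]
                 subst1_rename_Suc_comp[unfolded subst1_def]\<close>)
      next
        case (bot a)
        then show ?thesis using valid_sn[OF validI.prems] reducible_E sn_sub sub.intros by blast
      qed
    qed (auto intro: intro_cond_neutral)
  qed
qed

lemma reducible_Pr1:
  assumes "reducible (And A C) t"
  shows "reducible A (Pr1 t)"
  using valid_sn[OF assms(1)] assms
proof (induction rule: sn_induct)
  case (less t)
  show ?case
  proof (rule valid.validI)
    fix x assume "step (Pr1 t) x"
    then show "reducible A x"
    proof (cases rule: step_Pr1E)
      case (arg t')
      then show ?thesis using less.IH[OF belowp_step] valid_step[OF less.prems] by blast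
    next
      case (detour r)
      then show ?thesis using valid_intro[OF less.prems] by simp
    next
      case (perm a p q)
      show ?thesis
        unfolding perm(2)
        by (rule reducible_commute[where J = "intro_cond (And A C)" and G = "\<lambda>_. Pr1"])
          (use less.prems less.IH perm in \<open>auto simp: subst1_def\<close>)
    next
      case (bot a)
      then show ?thesis using valid_sn[OF less.prems] reducible_E sn_sub sub.intros by blast
    qed
  qed (auto intro: intro_cond_neutral)
qed

lemma reducible_Pr2:
  assumes "reducible (And A C) t"
  shows "reducible C (Pr2 t)"
  using valid_sn[OF assms(1)] assms
proof (induction rule: sn_induct)
  case (less t)
  show ?case
  proof (rule valid.validI)
    fix x assume "step (Pr2 t) x"
    then show "reducible C x"
    proof (cases rule: step_Pr2E)
      case (arg t')
      then show ?thesis using less.IH[OF belowp_step] valid_step[OF less.prems] by blast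
    next
      case (detour r)
      then show ?thesis using valid_intro[OF less.prems] by simp
    next
      case (perm a p q)
      show ?thesis
        unfolding perm(2)
        by (rule reducible_commute[where J = "intro_cond (And A C)" and G = "\<lambda>_. Pr2"])
          (use less.prems less.IH perm in \<open>auto simp: subst1_def\<close>)
    next
      case (bot a)
      then show ?thesis using valid_sn[OF less.prems] reducible_E sn_sub sub.intros by blast
    qed
  qed (auto intro: intro_cond_neutral)
qed

lemma reducible_Case:
  assumes "reducible (Or A C) t"
    and v: "\<And>\<rho> a. reducible A a \<Longrightarrow> reducible D (subst1 a (rename (up_ren 1 \<rho>) v))"
    and w: "\<And>\<rho> a. reducible C a \<Longrightarrow> reducible D (subst1 a (rename (up_ren 1 \<rho>) w))"
  shows "reducible D (Case t v w)"
proof (rule candidate.valid_Case[OF candidate_intro_cond])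
  show "good_scrutinee (reducible D) v w t"
    using assms(1) by (rule good_scrutinee_of_valid) (use v w in simp_all)
  show "reducible D v" "reducible D w"
    using v[OF reducible_Var, of 0 Suc] w[OF reducible_Var, of 0 Suc]
    by (simp_all add: subst1_Var_0_rename[unfolded One_nat_def])
qed

subsection \<open>Boxes\<close>

text \<open>A box with a hole among its arguments and everything else renamed, in the shape that
  \<open>good_scrutinee_of_Case\<close> expects of a frame and of a measure.\<close>

definition box_at :: "trm list \<Rightarrow> trm list \<Rightarrow> trm \<Rightarrow> (nat \<Rightarrow> nat) \<Rightarrow> trm \<Rightarrow> trm" where
  "box_at ts1 ts2 r \<rho> x = B (map (rename \<rho>) ts1 @ x # map (rename \<rho>) ts2)
     (rename (up_ren (Suc (length ts1 + length ts2)) \<rho>) r)"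

lemma box_at_id: "box_at ts1 ts2 r (\<lambda>j. j) x = B (ts1 @ x # ts2) r"
  by (simp add: box_at_def rename_id[abs_def] up_ren_id)

lemma box_at_step: "step x y \<Longrightarrow> step (box_at ts1 ts2 r \<rho> x) (box_at ts1 ts2 r \<rho> y)"
  by (simp add: box_at_def step_intros)

lemma rename_Suc_comp_rename: "rename Suc \<circ> rename \<rho> = rename (Suc \<circ> \<rho>)"
  by (simp add: fun_eq_iff rename_rename)

lemma box_at_Case: "step (box_at ts1 ts2 r \<rho> (Case a p q))
    (Case a (box_at ts1 ts2 r (Suc \<circ> \<rho>) p) (box_at ts1 ts2 r (Suc \<circ> \<rho>) q))"
  using step_intros(27)[of "Suc (length ts1 + length ts2)" "map (rename \<rho>) ts1" "map (rename \<rho>) ts2"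
      a p q "rename (up_ren (Suc (length ts1 + length ts2)) \<rho>) r"]
  by (simp add: box_at_def rename_rename up_ren_comp rename_Suc_comp_rename)

lemma box_at_subst1: "subst1 a (box_at ts1 ts2 r (Suc \<circ> \<rho>) x) = box_at ts1 ts2 r \<rho> (subst1 a x)"
  by (simp add: box_at_def subst1_def subst_up_rename_up_Suc_comp
      subst1_rename_Suc_comp[unfolded subst1_def] comp_def[of "subst _"])

lemma box_at_rename_up: "rename (up_ren 1 Suc) (box_at ts1 ts2 r (Suc \<circ> \<rho>) x)
    = box_at ts1 ts2 r (Suc \<circ> (Suc \<circ> \<rho>)) (rename (up_ren 1 Suc) x)"
  by (simp add: box_at_def rename_up_1_Suc_comp[unfolded One_nat_def] rename_up_up_Suc_comp
      comp_def[of "rename _"])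

lemma sn_box_at: "sn (box_at ts1 ts2 r \<rho> x) \<Longrightarrow> sn x"
proof (induction "box_at ts1 ts2 r \<rho> x" arbitrary: x rule: sn.induct)
  case snI
  then show ?case by (blast intro: sn.snI box_at_step)
qed

text \<open>In contrast to \<open>valid_commute\<close>, the filling is not known to be valid. What
  is known is that the source box around it is, so that box both admits fillings and measures them,
  while the frame is the target box.\<close>

lemma (in candidate) valid_box_commute:
  assumes T: "valid J (box_at ts1 ts2 r (\<lambda>j. j) (Case a p q))"
    and IH: "\<And>\<rho> x. valid J (box_at ts1 ts2 r \<rho> x) \<Longrightarrow>
      below\<^sup>+\<^sup>+ (box_at ts1 ts2 r \<rho> x) (box_at ts1 ts2 r (\<lambda>j. j) (Case a p q)) \<Longrightarrow>
      valid I (box_at us1 us2 s \<rho> x)"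
  shows "valid I (Case a (box_at us1 us2 s Suc p) (box_at us1 us2 s Suc q))"
proof -
  let ?H = "box_at ts1 ts2 r"
  have branch: "valid J (?H (Suc \<circ> \<rho>) p) \<and> valid J (?H (Suc \<circ> \<rho>) q) \<and>
      below\<^sup>+\<^sup>+ (?H (Suc \<circ> \<rho>) p) (?H \<rho> (Case a p q)) \<and> below\<^sup>+\<^sup>+ (?H (Suc \<circ> \<rho>) q) (?H \<rho> (Case a p q))"
    if "valid J (?H \<rho> (Case a p q))" for \<rho> a p q
    using valid_step[OF that box_at_Case] belowp_step[OF box_at_Case] belowp_sub sub.intros(2,3)
    by (meson valid_Case1 valid_Case2 tranclp_trans)
  have "good_scrutinee (valid I) (box_at us1 us2 s (Suc \<circ> (\<lambda>j. j)) p) (box_at us1 us2 s (Suc \<circ> (\<lambda>j. j)) q) a"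
    by (rule good_scrutinee_of_Case[where \<Phi> = "\<lambda>\<rho> x. valid J (?H \<rho> x)" and H = ?H
          and G = "box_at us1 us2 s" and \<rho> = "\<lambda>j. j"])
      (use T IH branch in \<open>auto simp: box_at_subst1 box_at_rename_up[unfolded One_nat_def]
         intro: valid_step box_at_step belowp_step sn_box_at valid_sn\<close>)
  moreover have "valid I (box_at us1 us2 s (Suc \<circ> (\<lambda>j. j)) p)" "valid I (box_at us1 us2 s (Suc \<circ> (\<lambda>j. j)) q)"
    using branch[OF T] IH by blast+
  ultimately show ?thesis by (auto simp: comp_def intro: valid_Case)
qed

lemma merge_body_Var_0: "merge_body 0 m 0 t (Var 0) = t"
  by (simp add: merge_body_def rename_id cong: if_cong)

text \<open>A merge, the conversion to the argument and a bot conversion at the root all yield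
  \<open>t\<close> itself; only the permutation needs the frame argument.\<close>

lemma reducible_box_Var:
  assumes "reducible (Nec A) t"
  shows "reducible (Nec A) (B [t] (Var 0))"
  using valid_sn[OF assms(1)] assms
proof (induction rule: sn_induct)
  case (less t)
  show ?case
  proof (rule valid.validI)
    fix x assume "step (B [t] (Var 0)) x"
    then show "reducible (Nec A) x"
    proof (cases rule: step_BE)
      case (arg ts1 t1 t' ts2)
      then show ?thesis
        using less.IH[OF belowp_step] valid_step[OF less.prems] by (auto simp: Cons_eq_append_conv)
    next
      case (body r')
      then show ?thesis using step_cases(1) by blast
    next
      case (merge ts1 ss u ts2)
      then show ?thesis using less.prems
        by (auto simp: Cons_eq_append_conv merge_body_Var_0)
    next
      case eta
      then show ?thesis using less.prems by simp
    next
      case (perm ts1 a p q ts2)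
      have x: "x = Case a (B [p] (Var 0)) (B [q] (Var 0))" and t: "t = Case a p q"
        using perm by (auto simp: Cons_eq_append_conv up_ren_def)
      show ?thesis
        unfolding x
        by (rule reducible_commute[where J = "intro_cond (Nec A)" and G = "\<lambda>_ t. B [t] (Var 0)"])
          (use less.prems less.IH t in \<open>auto simp: subst1_def up_sub_def up_ren_def\<close>)
    next
      case (bot ts1 a ts2)
      then show ?thesis using less.prems by (auto simp: Cons_eq_append_conv)
    qed
  qed (auto intro: reducible_Var)
qed

text \<open>
  In \<open>body_le\<close> the first \<open>n\<close> indices are those bound by a box; the others may only be renamed.
\<close>

definition body_le :: "'a form \<Rightarrow> 'a form \<Rightarrow> nat \<Rightarrow> trm \<Rightarrow> trm \<Rightarrow> bool" where
  "body_le A C n u w \<longleftrightarrow> (\<forall>\<theta>. (\<forall>j\<ge>n. \<exists>k. \<theta> j = Var k) \<longrightarrow>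
     reducible A (subst \<theta> u) \<longrightarrow> reducible C (subst \<theta> w))"

lemma body_le_reducible: "body_le A C n u w \<Longrightarrow> reducible A u \<Longrightarrow> reducible C w"
  unfolding body_le_def by (metis subst_Var)

lemma body_le_step: "body_le A C n u w \<Longrightarrow> step w w' \<Longrightarrow> body_le A C n u w'"
  unfolding body_le_def using step_subst valid_step by blast

lemma body_le_rename:
  "body_le A C n u w \<Longrightarrow> body_le A C n (rename (up_ren n \<rho>) u) (rename (up_ren n \<rho>) w)"
  unfolding body_le_def subst_rename by (auto simp: up_ren_def)

text \<open>The composed substitution takes \<open>j \<ge> Suc (k + l)\<close> to
  \<open>\<theta> (j - 1 + m)\<close>, with index at least \<open>k + m + l\<close>, hence to a
  variable. So it is again among the instances compared.\<close>

lemma body_le_merge: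
  assumes "body_le A C (Suc (k + l)) u w"
  shows "body_le A C (k + m + l) (merge_body k m l t u) (merge_body k m l t w)"
  unfolding body_le_def merge_body_def subst_subst
proof (intro allI impI)
  fix \<theta> :: "nat \<Rightarrow> trm"
  let ?\<mu> = "\<lambda>j. if j < k then Var j
                else if j = k then rename (\<lambda>i. if i < m then i + k else i + k + l) t
                else Var (j - 1 + m)"
  assume \<theta>: "\<forall>j\<ge>k + m + l. \<exists>i. \<theta> j = Var i" "reducible A (subst (subst \<theta> \<circ> ?\<mu>) u)"
  have "\<exists>i. (subst \<theta> \<circ> ?\<mu>) j = Var i" if "j \<ge> Suc (k + l)" for j
    using that \<theta>(1) by auto
  then show "reducible C (subst (subst \<theta> \<circ> ?\<mu>) w)"
    using assms \<theta>(2) unfolding body_le_def by blast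
qed

text \<open>
  The second conjunct covers the conversion \<open>B [s] (Var 0) > s\<close>, whose contractum is not
  an argument known to be reducible at the new type.
\<close>

lemma reducible_box_map:
  assumes "reducible (Nec A) (B ss u)" "body_le A C (length ss) u w"
  shows "reducible (Nec C) (B ss w) \<and> (\<forall>s. ss = [s] \<longrightarrow> w = Var 0 \<longrightarrow> reducible (Nec C) s)"
proof -
  define T where "T = B ss u"
  have "sn T" using assms(1) valid_sn T_def by blast
  then show ?thesis using T_def assms
  proof (induction arbitrary: ss u w rule: sn_induct)
    case (less T)
    note IH = less.IH[OF _ refl]
    note T = less.prems(2)[folded less.prems(1)]
    have box_eta: "reducible (Nec C) s" if s: "ss = [s]" and le: "body_le A C (length ss) u (Var 0)" for s
    proof (rule valid.validI)
      fix s' assume "step s s'"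
      then have "step T (B [s'] u)"
        unfolding less.prems s using step_intros(14)[of _ s s' "[]" "[]"] by simp
      then show "reducible (Nec C) s'"
        using IH[of "[s']" u "Var 0"] belowp_step valid_step[OF T] le s by auto
    next
      show "intro_cond (Nec C) s"
      proof (cases "\<exists>qs t. s = B qs t")
        case True
        then obtain qs t where s': "s = B qs t" by blast
        \<comment> \<open>Merging \<open>s\<close> into the known box puts \<open>t\<close> for
          variable 0 of \<open>u\<close>. The same merge turns the body \<open>Var 0\<close> into
          \<open>t\<close>, so the comparison carries reducibility over to \<open>t\<close>.\<close>
        have "step T (B qs (merge_body 0 (length qs) 0 t u))"
          unfolding less.prems s s' using step_intros(21)[of "[]" qs t "[]" u] by simp
        then have "reducible A (merge_body 0 (length qs) 0 t u)"
          using valid_step[OF T] valid_intro by fastforce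
        moreover have "body_le A C (length qs) (merge_body 0 (length qs) 0 t u) t"
          using body_le_merge[where k = 0 and l = 0 and m = "length qs" and t = t] le s
          by (fastforce simp: merge_body_Var_0)
        ultimately show ?thesis unfolding s' by (simp add: body_le_reducible)
      qed (simp add: intro_cond.simps)
    next
      fix a p q assume s': "s = Case a p q"
      let ?H = "box_at [] [] u (Suc \<circ> (\<lambda>j. j))"
      have H: "?H x = B [x] (rename (up_ren 1 Suc) u)" for x
        by (simp add: box_at_def comp_def)
      \<comment> \<open>The branches of this reduct of \<open>T\<close> are one-argument boxes over
        \<open>p\<close> and \<open>q\<close>; the second conjunct of the induction hypothesis then
        yields \<open>p\<close> and \<open>q\<close>.\<close>
      have *: "step T (Case a (?H p) (?H q))"
        using box_at_Case[of "[]" "[]" u "\<lambda>j. j"] unfolding less.prems s s' box_at_id by simp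
      have le': "body_le A C (Suc 0) (rename (up_ren 1 Suc) u) (Var 0)"
        using body_le_rename[OF le, of Suc] s by (simp add: up_ren_def)
      have "below\<^sup>+\<^sup>+ (?H p) T" "below\<^sup>+\<^sup>+ (?H q) T"
        using belowp_step[OF *] belowp_sub sub.intros(2,3) by (meson tranclp_trans)+
      moreover have "reducible (Nec A) (?H p)" "reducible (Nec A) (?H q)"
        using valid_step[OF T *] valid_Case1 valid_Case2 by blast+
      ultimately show "reducible (Nec C) p" "reducible (Nec C) q"
        using IH le' unfolding H by fastforce+
    qed
    have "reducible C w"
      using body_le_reducible less.prems(2,3) valid_intro by fastforce
    \<comment> \<open>Activity in the arguments is mirrored in \<open>T\<close> and decreases it.
      Steps of \<open>w\<close> leave \<open>T\<close> unchanged and need an induction of their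
      own.\<close>
    then have "reducible (Nec C) (B ss w)"
      using less.prems(3)
    proof (induction rule: valid.induct)
      case (validI w)
      have w: "reducible C w" using validI by (blast intro: valid.validI)
      show ?case
      proof (rule valid.validI)
        fix x assume "step (B ss w) x"
        then show "reducible (Nec C) x"
        proof (cases rule: step_BE)
          case (arg ss1 s s' ss2)
          then have "step T (B (ss1 @ s' # ss2) u)" unfolding less.prems by (simp add: step_intros)
          then show ?thesis
            using IH[of "ss1 @ s' # ss2" u w] belowp_step valid_step[OF T] validI.prems(1) arg by auto
        next
          case (body w')
          then show ?thesis using validI.IH(1) validI.prems body_le_step by blast
        next
          case (merge ss1 qs t ss2)
          have "step T (B (ss1 @ qs @ ss2) (merge_body (length ss1) (length qs) (length ss2) t u))"
            unfolding less.prems merge by (rule step_intros)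
          moreover have "body_le A C (length (ss1 @ qs @ ss2))
              (merge_body (length ss1) (length qs) (length ss2) t u)
              (merge_body (length ss1) (length qs) (length ss2) t w)"
            using body_le_merge[of A C "length ss1" "length ss2" u w "length qs" t] validI.prems(1) merge
            by (simp add: add.assoc)
          ultimately show ?thesis
            unfolding merge(2) using IH belowp_step valid_step[OF T] by blast
        next
          case eta
          show ?thesis using validI.prems unfolding eta(2) by (rule box_eta[OF eta(1)])
        next
          case (perm ss1 a p q ss2)
          have T': "T = box_at ss1 ss2 u (\<lambda>j. j) (Case a p q)"
            unfolding less.prems perm box_at_id ..
          have "reducible (Nec C) (box_at ss1 ss2 w \<rho> x)"
            if "reducible (Nec A) (box_at ss1 ss2 u \<rho> x)" "below\<^sup>+\<^sup>+ (box_at ss1 ss2 u \<rho> x) T" for \<rho> x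
            using IH[OF that(2)[unfolded box_at_def] that(1)[unfolded box_at_def],
                of "rename (up_ren (Suc (length ss1 + length ss2)) \<rho>) w"]
              body_le_rename[OF validI.prems(1), of \<rho>] perm
            by (simp add: box_at_def)
          then show ?thesis
            using candidate.valid_box_commute[OF candidate_intro_cond, of "intro_cond (Nec A)" ss1 ss2 u a p q "Nec C" ss1 ss2 w]
              T T' perm by (simp add: box_at_def)
        next
          case (bot ss1 a ss2)
          have "step T (E a)" unfolding less.prems bot by (rule step_intros)
          then have "sn a" using T valid_step valid_sn sn_sub sub.intros(4) by blast
          then show ?thesis unfolding bot by (rule reducible_E)
        qed
      qed (use w in auto)
    qed
    then show ?case using box_eta less.prems(3) by blast
  qed
qed

text \<open>The joint scope lists the \<open>m\<close> variables of the first box, then the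
  \<open>n\<close> of the second: in \<open>u\<close> only the free indices move, in
  \<open>v\<close> all of them do.\<close>

definition pair_bodies :: "nat \<Rightarrow> nat \<Rightarrow> trm \<Rightarrow> trm \<Rightarrow> trm" where
  "pair_bodies m n u v =
     Pair (rename (\<lambda>i. if i < m then i else i + n) u) (rename (\<lambda>i. i + m) v)"

lemma pair_bodies_rename:
  "rename (up_ren (m + n) \<rho>) (pair_bodies m n u v)
   = pair_bodies m n (rename (up_ren m \<rho>) u) (rename (up_ren n \<rho>) v)"
  by (auto simp: pair_bodies_def rename_rename up_ren_def intro!: arg_cong2[where f = rename])

text \<open>Seen from the joint box, the merged argument has the \<open>n\<close> arguments of the
  second box on its right, hence \<open>l + n\<close>.\<close>

lemma pair_bodies_merge_left:
  "pair_bodies (k + m + l) n (merge_body k m l t u) v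
   = merge_body k m (l + n) t (pair_bodies (Suc (k + l)) n u v)"
  by (auto simp: pair_bodies_def merge_body_def compose_simps rename_eq_subst[of "\<lambda>i. i + _" v]
      fun_eq_iff intro!: arg_cong2[where f = subst] arg_cong2[where f = rename])

lemma pair_bodies_merge_right:
  "pair_bodies n (k + m + l) u (merge_body k m l t v)
   = merge_body (n + k) m l t (pair_bodies n (Suc (k + l)) u v)"
  by (auto simp: pair_bodies_def merge_body_def compose_simps
      rename_eq_subst[of "\<lambda>i. if _ i then i else i + _" u]
      fun_eq_iff intro!: arg_cong2[where f = subst] arg_cong2[where f = rename])

lemma belowp_rename_right: "below\<^sup>+\<^sup>+ x (rename \<rho> t) \<Longrightarrow> below\<^sup>+\<^sup>+ x t"
  by (erule tranclp.cases) (auto dest: below_rename_right intro: tranclp.intros)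

text \<open>Each step of the joint box stems from a step of one of the two boxes, since a pair as
  body rules out the conversion of \<open>B [t] (Var 0)\<close>. The induction is lexicographic: a
  permutation in the first box weakens the second.\<close>

lemma reducible_box_pair:
  assumes "reducible (Nec A) (B ss u)" "reducible (Nec C) (B qs v)"
  shows "reducible (Nec (And A C)) (B (ss @ qs) (pair_bodies (length ss) (length qs) u v))"
proof -
  define T where "T = B ss u"
  have "sn T" using assms(1) valid_sn T_def by blast
  then show ?thesis using T_def assms
  proof (induction arbitrary: ss u qs v rule: sn_induct)
    case (less T)
    note outer = less.IH[OF _ refl]
    define T2 where "T2 = B qs v"
    have "sn T2" using less.prems(3) valid_sn T2_def by blast
    moreover have "below\<^sup>+\<^sup>+ x T" if "below\<^sup>+\<^sup>+ x (B ss u)" for x using that less.prems(1) by simp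
    ultimately show ?case using T2_def less.prems(2,3)
    \<comment> \<open>\<open>B ss u\<close> need not be \<open>T\<close> here: permutations in the second box weaken it\<close>
    proof (induction arbitrary: ss u qs v rule: sn_induct)
      case (less T2)
      note inner = less.IH[OF _ _ refl]
      note T1 = less.prems(3) and T2 = less.prems(4)
      note below_T = less.prems(1)
      let ?w = "pair_bodies (length ss) (length qs) u v"
      have left: "reducible (Nec (And A C)) (B (ss' @ qs) (pair_bodies (length ss') (length qs) u' v))"
        if "step (B ss u) (B ss' u')" for ss' u'
        using outer below_T belowp_step[OF that] valid_step[OF T1 that] T2 by blast
      have right: "reducible (Nec (And A C)) (B (ss @ qs') (pair_bodies (length ss) (length qs') u v'))"
        if "step (B qs v) (B qs' v')" for qs' v'
        using inner[OF _ below_T] belowp_step[OF that] valid_step[OF T2 that] T1 less.prems(2) by blast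
      show ?case
      proof (rule valid.validI)
        fix x assume "step (B (ss @ qs) ?w) x"
        then show "reducible (Nec (And A C)) x"
        proof (cases rule: step_BE)
          case (arg ts1 t t' ts2)
          from arg(1) consider r where "ss = ts1 @ t # r" "ts2 = r @ qs"
            | r where "qs = r @ t # ts2" "ts1 = ss @ r"
            by (auto simp: append_eq_append_conv2 Cons_eq_append_conv append_eq_Cons_conv)
          then show ?thesis
          proof cases
            case 1
            then show ?thesis using left[of "ts1 @ t' # r" u] arg(2,3) by (simp add: step_intros)
          next
            case 2
            then show ?thesis using right[of "r @ t' # ts2" v] arg(2,3) by (simp add: step_intros)
          qed
        next
          case (body w)
          then consider u' where "w = Pair u' (rename (\<lambda>i. i + length ss) v)"
              "step (rename (\<lambda>i. if i < length ss then i else i + length qs) u) u'"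
            | v' where "w = Pair (rename (\<lambda>i. if i < length ss then i else i + length qs) u) v'"
              "step (rename (\<lambda>i. i + length ss) v) v'"
            unfolding pair_bodies_def using step_cases(3) by blast
          then show ?thesis
          proof cases
            case 1
            from step_rename_inv[OF 1(2)] obtain u1 where "step u u1"
              "u' = rename (\<lambda>i. if i < length ss then i else i + length qs) u1" by blast
            with 1 body show ?thesis using left[of ss u1] by (simp add: step_intros pair_bodies_def)
          next
            case 2
            from step_rename_inv[OF 2(2)] obtain v1 where "step v v1"
              "v' = rename (\<lambda>i. i + length ss) v1" by blast
            with 2 body show ?thesis using right[of qs v1] by (simp add: step_intros pair_bodies_def)
          qed
        next
          case (merge ts1 xs t ts2)
          from merge(1) consider r where "ss = ts1 @ B xs t # r" "ts2 = r @ qs"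
            | r where "qs = r @ B xs t # ts2" "ts1 = ss @ r"
            by (auto simp: append_eq_append_conv2 Cons_eq_append_conv append_eq_Cons_conv)
          then show ?thesis
          proof cases
            case 1
            have "step (B ss u) (B (ts1 @ xs @ r) (merge_body (length ts1) (length xs) (length r) t u))"
              unfolding 1 by (rule step_intros)
            from left[OF this] show ?thesis unfolding merge(2) 1
              using pair_bodies_merge_left[of "length ts1" "length xs" "length r" "length qs" t u v]
              by (simp add: add.assoc)
          next
            case 2
            have "step (B qs v) (B (r @ xs @ ts2) (merge_body (length r) (length xs) (length ts2) t v))"
              unfolding 2 by (rule step_intros)
            from right[OF this] show ?thesis unfolding merge(2) 2
              using pair_bodies_merge_right[of "length ss" "length r" "length xs" "length ts2" u t v]
              by (simp add: add.assoc)
          qed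
        next
          case eta
          then show ?thesis by (simp add: pair_bodies_def)
        next
          case (perm ts1 a p q ts2)
          have x: "x = Case a (box_at ts1 ts2 ?w Suc p) (box_at ts1 ts2 ?w Suc q)"
            using perm by (simp add: box_at_def)
          have ren: "reducible (Nec A) (B (map (rename \<rho>) ss) (rename (up_ren (length ss) \<rho>) u))"
            "reducible (Nec C) (B (map (rename \<rho>) qs) (rename (up_ren (length qs) \<rho>) v))" for \<rho>
            using reducible_rename[OF T1, of \<rho>] reducible_rename[OF T2, of \<rho>] by simp_all
          from perm(1) consider r where "ss = ts1 @ Case a p q # r" "ts2 = r @ qs"
            | r where "qs = r @ Case a p q # ts2" "ts1 = ss @ r"
            by (auto simp: append_eq_append_conv2 Cons_eq_append_conv append_eq_Cons_conv)
          then show ?thesis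
          proof cases
            case 1
            have H: "box_at ts1 r u (\<lambda>j. j) (Case a p q) = B ss u"
              unfolding box_at_id 1 ..
            show ?thesis
              unfolding x
            proof (rule candidate.valid_box_commute[OF candidate_intro_cond, of "intro_cond (Nec A)" ts1 r u])
              fix \<rho> y
              assume *: "reducible (Nec A) (box_at ts1 r u \<rho> y)"
                "below\<^sup>+\<^sup>+ (box_at ts1 r u \<rho> y) (box_at ts1 r u (\<lambda>j. j) (Case a p q))"
              show "reducible (Nec (And A C)) (box_at ts1 ts2 ?w \<rho> y)"
                using outer[OF below_T[OF *(2)[unfolded H], unfolded box_at_def]
                    *(1)[unfolded box_at_def] ren(2)[of \<rho>]] 1
                  pair_bodies_rename[of "length ss" "length qs" \<rho> u v]
                by (simp add: box_at_def add.assoc)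
            qed (use T1 H in simp)
          next
            case 2
            have H: "box_at r ts2 v (\<lambda>j. j) (Case a p q) = T2"
              unfolding box_at_id less.prems(2) 2 ..
            show ?thesis
              unfolding x
            proof (rule candidate.valid_box_commute[OF candidate_intro_cond, of "intro_cond (Nec C)" r ts2 v])
              fix \<rho> y
              assume *: "reducible (Nec C) (box_at r ts2 v \<rho> y)"
                "below\<^sup>+\<^sup>+ (box_at r ts2 v \<rho> y) (box_at r ts2 v (\<lambda>j. j) (Case a p q))"
              \<comment> \<open>The weakened first box has nothing below it that the original lacks,
                so it still fits under \<open>T\<close>.\<close>
              have "below\<^sup>+\<^sup>+ z T"
                if "below\<^sup>+\<^sup>+ z (B (map (rename \<rho>) ss) (rename (up_ren (length ss) \<rho>) u))" for z
                using belowp_rename_right[of z \<rho> "B ss u"] that below_T by simp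
              from inner[OF *(2)[unfolded H, unfolded box_at_def] this ren(1)[of \<rho>]
                  *(1)[unfolded box_at_def]]
              show "reducible (Nec (And A C)) (box_at ts1 ts2 ?w \<rho> y)"
                using 2 pair_bodies_rename[of "length ss" "length qs" \<rho> u v]
                by (simp add: box_at_def add.assoc)
            qed (use T2 H less.prems(2) in simp)
          qed
        next
          case (bot ts1 a ts2)
          from this(1) have "(\<exists>r. ss = ts1 @ E a # r) \<or> (\<exists>r. qs = r @ E a # ts2)"
            by (auto simp: append_eq_append_conv2 Cons_eq_append_conv append_eq_Cons_conv)
          then have "step (B ss u) (E a) \<or> step (B qs v) (E a)"
            using step_intros(34) by blast
          then have "sn (E a)" using T1 T2 valid_step valid_sn by blast
          then show ?thesis unfolding bot using reducible_E sn_sub sub.intros(4) by blast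
        qed
      next
        show "intro_cond (Nec (And A C)) (B (ss @ qs) ?w)"
          using valid_intro[OF T1] valid_intro[OF T2]
          by (simp add: pair_bodies_def reducible_Pair reducible_rename)
      qed simp_all
    qed
  qed
qed

subsection \<open>Adequacy\<close>

text \<open>The last component is a terminator: in \<open>tuple 0 n\<close> it is index
  \<open>n\<close>, just outside the \<open>n\<close> bound variables. It treats the empty list
  uniformly.\<close>

primrec tuple :: "nat \<Rightarrow> nat \<Rightarrow> trm" where
  "tuple k 0 = Var k"
| "tuple k (Suc n) = Pair (Var k) (tuple (Suc k) n)"

text \<open>\<open>Bot\<close> is an arbitrary choice for the terminator, variables being reducible
  at every formula.\<close>

primrec conj_form :: "'a form list \<Rightarrow> 'a form" where
  "conj_form [] = Bot"
| "conj_form (A # As) = And A (conj_form As)"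

lemma rename_tuple: "rename (\<lambda>i. i + m) (tuple k n) = tuple (k + m) n"
  by (induction n arbitrary: k) auto

lemma reducible_box_tuple:
  "list_all2 (\<lambda>t A. reducible (Nec A) t) ts As \<Longrightarrow>
   reducible (Nec (conj_form As)) (B ts (tuple 0 (length ts)))"
proof (induction rule: list_all2_induct)
  case Nil
  show ?case
    by (rule valid.validI) (auto elim!: step_BE dest: step_cases(1) intro: reducible_Var)
next
  case (Cons t ts A As)
  then show ?case
    using reducible_box_pair[OF reducible_box_Var Cons.IH]
    by (simp add: pair_bodies_def rename_tuple[where m = 1, simplified])
qed

text \<open>Under substitution a tuple remains a literal nest of pairs, so the introduction clause
  alone extracts its components.\<close>

lemma reducible_subst_tuple:
  "reducible (conj_form As) (subst \<theta> (tuple k (length As))) \<Longrightarrow> i < length As \<Longrightarrow>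
   reducible (As ! i) (\<theta> (k + i))"
proof (induction As arbitrary: k i)
  case (Cons A As)
  from valid_intro[OF Cons.prems(1)] have "reducible A (\<theta> k)"
    "reducible (conj_form As) (subst \<theta> (tuple (Suc k) (length As)))" by simp_all
  with Cons.IH[of "Suc k"] Cons.prems(2) show ?case by (cases i) auto
qed simp

lemma subst1_rename_up_subst:
  "subst1 a (rename (up_ren 1 \<rho>) (subst (up_sub 1 \<sigma>) t))
   = subst (\<lambda>j. case j of 0 \<Rightarrow> a | Suc k \<Rightarrow> rename \<rho> (\<sigma> k)) t"
  unfolding subst1_def compose_simps
  by (auto simp: up_sub_def up_ren_def compose_simps rename_eq_subst comp_def
      intro!: arg_cong2[where f = subst] ext split: nat.splits)

lemma reducible_subst:
  "\<Gamma> \<turnstile> t : A \<Longrightarrow> (\<And>j. j < length \<Gamma> \<Longrightarrow> reducible (\<Gamma> ! j) (\<sigma> j)) \<Longrightarrow> reducible A (subst \<sigma> t)"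
proof (induction arbitrary: \<sigma> rule: typed.induct)
  case (typed_Var j \<Gamma>)
  then show ?case by simp
next
  case (typed_Lam A \<Gamma> t C)
  show ?case
    unfolding subst.simps
    by (rule reducible_Lam, unfold subst1_rename_up_subst, rule typed_Lam.IH)
      (use typed_Lam.prems in \<open>auto simp: nth_Cons reducible_rename split: nat.splits\<close>)
next
  case (typed_App \<Gamma> t A C s)
  then show ?case by (auto intro: reducible_App)
next
  case (typed_Pair \<Gamma> t A s C)
  then show ?case by (auto intro: reducible_Pair)
next
  case (typed_Pr1 \<Gamma> t A C)
  then show ?case by (auto intro: reducible_Pr1)
next
  case (typed_Pr2 \<Gamma> t A C)
  then show ?case by (auto intro: reducible_Pr2)
next
  case (typed_In1 \<Gamma> t A C)
  then show ?case by (auto intro: reducible_In1)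
next
  case (typed_In2 \<Gamma> t C A)
  then show ?case by (auto intro: reducible_In2)
next
  case (typed_Case \<Gamma> t A C t1 D t2)
  show ?case
    unfolding subst.simps
  proof (rule reducible_Case)
    show "reducible (Or A C) (subst \<sigma> t)" using typed_Case by blast
    show "reducible D (subst1 a (rename (up_ren 1 \<rho>) (subst (up_sub 1 \<sigma>) t1)))"
      if "reducible A a" for \<rho> a
      unfolding subst1_rename_up_subst
      by (rule typed_Case.IH)
        (use typed_Case.prems that in \<open>auto simp: nth_Cons reducible_rename split: nat.splits\<close>)
    show "reducible D (subst1 a (rename (up_ren 1 \<rho>) (subst (up_sub 1 \<sigma>) t2)))"
      if "reducible C a" for \<rho> a
      unfolding subst1_rename_up_subst
      by (rule typed_Case.IH)
        (use typed_Case.prems that in \<open>auto simp: nth_Cons reducible_rename split: nat.splits\<close>)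
  qed
next
  case (typed_E \<Gamma> t A)
  then show ?case by (auto intro: reducible_E valid_sn)
next
  case (typed_B \<Gamma> ts As s C)
  let ?ts = "map (subst \<sigma>) ts" and ?s = "subst (up_sub (length ts) \<sigma>) s"
  have len: "length ts = length As" using typed_B.IH(1) by (rule list_all2_lengthD)
  have "list_all2 (\<lambda>t A. reducible (Nec A) t) ?ts As"
    using typed_B.IH(1) unfolding list_all2_map1
    by (rule list_all2_mono) (use typed_B.prems in blast)
  then have "reducible (Nec (conj_form As)) (B ?ts (tuple 0 (length ?ts)))"
    by (rule reducible_box_tuple)
  \<comment> \<open>A reducible instance of the tuple makes \<open>\<theta>\<close> reducible on the
    bound indices; on the others \<open>\<theta>\<close> is a renaming, which keeps the values of
    \<open>\<sigma>\<close> reducible. So the induction hypothesis applies to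
    \<open>s\<close>.\<close>
  moreover have "body_le (conj_form As) C (length ?ts) (tuple 0 (length ?ts)) ?s"
    unfolding body_le_def
  proof (intro allI impI)
    fix \<theta> :: "nat \<Rightarrow> trm"
    assume var: "\<forall>j\<ge>length ?ts. \<exists>k. \<theta> j = Var k"
      and tup: "reducible (conj_form As) (subst \<theta> (tuple 0 (length ?ts)))"
    have \<theta>: "reducible (As ! i) (\<theta> i)" if "i < length As" for i
      using reducible_subst_tuple[of As \<theta> 0 i] tup that len by simp
    from var obtain \<rho> where \<rho>: "\<theta> j = Var (\<rho> j)" if "j \<ge> length As" for j
      using len by (metis length_map)
    show "reducible C (subst \<theta> ?s)"
      unfolding subst_subst
    proof (rule typed_B.IH(2))
      fix j assume j: "j < length (As @ \<Gamma>)"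
      show "reducible ((As @ \<Gamma>) ! j) ((subst \<theta> \<circ> up_sub (length ts) \<sigma>) j)"
      proof (cases "j < length As")
        case True
        then show ?thesis using \<theta> len by (simp add: up_sub_def nth_append)
      next
        case False
        have "subst \<theta> (rename (\<lambda>k. k + length ts) (\<sigma> (j - length ts)))
            = rename (\<lambda>k. \<rho> (k + length ts)) (\<sigma> (j - length ts))"
          unfolding subst_rename rename_eq_subst[of "\<lambda>k. \<rho> (k + length ts)"]
          using \<rho> len by (simp add: comp_def)
        then show ?thesis
          using False j len typed_B.prems by (simp add: up_sub_def nth_append reducible_rename)
      qed
    qed
  qed
  ultimately show ?case using reducible_box_map by fastforce
qed

theorem theorem26:
  fixes \<Gamma> :: "'a form list" and t :: trm and A :: "'a form"
  assumes "\<Gamma> \<turnstile> t : A"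
  shows "strongly_normalizing red t"
proof -
  have "reducible A (subst Var t)"
    using assms by (rule reducible_subst) (rule reducible_Var)
  then show ?thesis by (simp add: subst_Var valid_sn sn_imp_strongly_normalizing)
qed

end
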